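(* Let $\mathcal{L}(\Theta)\subseteq\mathcal{P}(\Theta)$, $\lambda>0$, $P\in\mathcal{L}(\Theta)$ (fixed independently of the data) and $\delta\in(0,1]$. Let $$Q_n\in\operatorname{argmin}_{Q\in\mathcal{L}(\Theta)}\Big\{\hat{R}^{\lambda\text{-}\mathrm{LIN}}_n(\pi_Q)+\frac{\mathcal{KL}(Q\|P)}{\lambda n}\Big\},\qquad \hat\pi_n^{\mathrm{L}}=\pi_{Q_n},\qquad Q^*\in\operatorname{argmin}_{Q\in\mathcal{L}(\Theta)}R(\pi_Q).$$ Then, with probability at least $1-\delta$ over the logged data $\mathcal{D}_n$, $$0\le R(\hat\pi_n^{\mathrm{L}})-R(\pi_{Q^*})\le\lambda\,\mathcal{S}^{\mathrm{LIN}}_\lambda(\pi_{Q^*})+\frac{2\big(\mathcal{KL}(Q^*\|P)+\ln(2/\delta)\big)}{\lambda n}.$$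
   Context: Setting (offline contextual bandit). $\mathcal{X}\subset\mathbb{R}^d$ is a compact context space, $\mathcal{A}=\{1,\dots,K\}=[K]$ a finite action set, $\nu$ a probability distribution on $\mathcal{X}$. A policy $\pi$ assigns to each $x\in\mathcal{X}$ a probability distribution $\pi(\cdot|x)$ on $\mathcal{A}$; $\pi_0$ is a fixed behavior policy. Given $(x,a)$, a cost $c\in[-1,0]$ is drawn from a distribution $p(\cdot|x,a)$, with mean $c(x,a)$. The logged data $\mathcal{D}_n=(x_i,a_i,c_i)_{i\in[n]}$ consists of $n$ i.i.d. tuples with $x_i\sim\nu$, $a_i\sim\pi_0(\cdot|x_i)$, $c_i\sim p(\cdot|x_i,a_i)$. The risk of a policy is $R(\pi)=\mathbb{E}_{x\sim\nu,\,a\sim\pi(\cdot|x)}[c(x,a)]$. PAC-Bayesian policies. $\{f_\theta:\mathcal{X}\to[K],\ \theta\in\Theta\}$ is a set of parameterized (measurable) predictors and $\mathcal{P}(\Theta)$ is the set of probability distributions on $\Theta$. Each $Q\in\mathcal{P}(\Theta)$ defines a policy $\pi_Q(a|x)=\mathbb{E}_{\theta\sim Q}\big[\mathbf{1}[f_\theta(x)=a]\big]$. The minimizers $Q_n$ and $Q^*$ are assumed to exist. $\mathcal{KL}(Q\|P)$ is the Kullback-Leibler divergence from $P$ to $Q$. Coverage assumption on the optimal policy: for $\nu$-almost every $x$ and every $a$, $\pi_{Q^*}(a|x)>0$ implies $\pi_0(a|x)>0$. Notation. $$\hat{R}^{\lambda\text{-}\mathrm{LIN}}_n(\pi)=-\frac1n\sum_{i=1}^n\frac{\pi(a_i|x_i)}{\lambda}\log\Big(1-\frac{\lambda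 c_i}{\pi_0(a_i|x_i)}\Big),\qquad \mathcal{S}^{\mathrm{LIN}}_\lambda(\pi)=\mathbb{E}\left[\frac{\pi(a|x)c^2}{\pi_0(a|x)^2-\lambda\pi_0(a|x)c}\right],$$ where the expectation is over $x\sim\nu$, $a\sim\pi_0(\cdot|x)$, $c\sim p(\cdot|x,a)$. *)

theory Defs
  imports "HOL-Probability.Probability"
begin

text \<open>
  Contexts are elements of a set \<open>X\<close> in \<open>real ^ 'd\<close>, actions are the naturals \<open>1, \<dots>, K\<close>, and costs
  are reals in \<open>[-1, 0]\<close>.
\<close>

definition context_space :: "(real ^ 'd) set \<Rightarrow> (real ^ 'd) measure" where
  "context_space X = restrict_space borel X"

definition action_space :: "nat \<Rightarrow> nat measure" where
  "action_space K = count_space {1..K}"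

definition cost_space :: "real measure" where
  "cost_space = restrict_space borel {-1..0}"

definition log_space :: "(real ^ 'd) set \<Rightarrow> nat \<Rightarrow> ((real ^ 'd) \<times> nat \<times> real) measure" where
  "log_space X K = context_space X \<Otimes>\<^sub>M action_space K \<Otimes>\<^sub>M cost_space"

text \<open>A policy is given by its weights: \<open>\<pi> x a\<close> stands for \<open>\<pi>(a | x)\<close>; only \<open>x \<in> X\<close>, \<open>a \<in> {1..K}\<close> matter.\<close>

type_synonym 'd policy = "real ^ 'd \<Rightarrow> nat \<Rightarrow> real"

definition is_policy :: "(real ^ 'd) set \<Rightarrow> nat \<Rightarrow> 'd policy \<Rightarrow> bool" where
  "is_policy X K \<pi> \<longleftrightarrow>
     (\<forall>x\<in>X. (\<forall>a\<in>{1..K}. 0 \<le> \<pi> x a) \<and> (\<Sum>a\<in>{1..K}. \<pi> x a) = 1) \<and>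
     (\<forall>a\<in>{1..K}. (\<lambda>x. \<pi> x a) \<in> borel_measurable (context_space X))"

definition action_dist :: "nat \<Rightarrow> 'd policy \<Rightarrow> real ^ 'd \<Rightarrow> nat measure" where
  "action_dist K \<pi> x = point_measure {1..K} (\<lambda>a. ennreal (\<pi> x a))"

definition mean_cost :: "(real ^ 'd \<Rightarrow> nat \<Rightarrow> real measure) \<Rightarrow> real ^ 'd \<Rightarrow> nat \<Rightarrow> real" where
  "mean_cost p x a = (\<integral>c. c \<partial>p x a)"

definition risk ::
  "nat \<Rightarrow> (real ^ 'd) measure \<Rightarrow> (real ^ 'd \<Rightarrow> nat \<Rightarrow> real measure) \<Rightarrow> 'd policy \<Rightarrow> real" where
  "risk K \<nu> p \<pi> = (\<integral>x. (\<integral>a. mean_cost p x a \<partial>action_dist K \<pi> x) \<partial>\<nu>)"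

text \<open>The law of one logged tuple: \<open>x \<sim> \<nu>\<close>, \<open>a \<sim> \<pi>0(\<cdot> | x)\<close>, \<open>c \<sim> p(\<cdot> | x, a)\<close>.\<close>

definition log_dist ::
  "(real ^ 'd) set \<Rightarrow> nat \<Rightarrow> (real ^ 'd) measure \<Rightarrow> 'd policy \<Rightarrow>
   (real ^ 'd \<Rightarrow> nat \<Rightarrow> real measure) \<Rightarrow> ((real ^ 'd) \<times> nat \<times> real) measure" where
  "log_dist X K \<nu> \<pi>0 p =
     \<nu> \<bind> (\<lambda>x. action_dist K \<pi>0 x \<bind> (\<lambda>a. p x a \<bind> (\<lambda>c. return (log_space X K) (x, a, c))))"

definition data_dist ::
  "(real ^ 'd) set \<Rightarrow> nat \<Rightarrow> (real ^ 'd) measure \<Rightarrow> 'd policy \<Rightarrow>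
   (real ^ 'd \<Rightarrow> nat \<Rightarrow> real measure) \<Rightarrow> nat \<Rightarrow> (nat \<Rightarrow> (real ^ 'd) \<times> nat \<times> real) measure" where
  "data_dist X K \<nu> \<pi>0 p n = (\<Pi>\<^sub>M i\<in>{1..n}. log_dist X K \<nu> \<pi>0 p)"

definition pac_policy ::
  "('t \<Rightarrow> real ^ 'd \<Rightarrow> nat) \<Rightarrow> 't measure \<Rightarrow> 'd policy" where
  "pac_policy f Q x a = (\<integral>\<theta>. of_bool (f \<theta> x = a) \<partial>Q)"

text \<open>
  \<open>KL_divergence b P Q\<close> of the library is the real-valued divergence from \<open>P\<close> to \<open>Q\<close>; it takes a
  meaningless finite value when the true divergence is infinite, that is, when \<open>Q\<close> is not absolutely
  continuous with respect to \<open>P\<close> or the log-density (whose negative part is always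
  \<open>Q\<close>-integrable) is not \<open>Q\<close>-integrable.
\<close>

definition KL :: "'t measure \<Rightarrow> 't measure \<Rightarrow> ereal" where
  "KL Q P =
     (if absolutely_continuous P Q \<and> integrable Q (entropy_density (exp 1) P Q)
      then ereal (KL_divergence (exp 1) P Q) else \<infinity>)"

definition lin_risk_estimate ::
  "real \<Rightarrow> 'd policy \<Rightarrow> nat \<Rightarrow> (nat \<Rightarrow> (real ^ 'd) \<times> nat \<times> real) \<Rightarrow> 'd policy \<Rightarrow> real" where
  "lin_risk_estimate lam \<pi>0 n D \<pi> =
     - (1 / real n) *
       (\<Sum>i\<in>{1..n}. (case D i of (x, a, c) \<Rightarrow> \<pi> x a / lam * ln (1 - lam * c / \<pi>0 x a)))"

definition S_lin ::
  "(real ^ 'd) set \<Rightarrow> nat \<Rightarrow> (real ^ 'd) measure \<Rightarrow> 'd policy \<Rightarrow>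
   (real ^ 'd \<Rightarrow> nat \<Rightarrow> real measure) \<Rightarrow> real \<Rightarrow> 'd policy \<Rightarrow> real" where
  "S_lin X K \<nu> \<pi>0 p lam \<pi> =
     (\<integral>(x, a, c). \<pi> x a * c\<^sup>2 / ((\<pi>0 x a)\<^sup>2 - lam * \<pi>0 x a * c) \<partial>log_dist X K \<nu> \<pi>0 p)"

end

theory Submission
  imports Defs
begin

text \<open>
  Put \<open>y = - \<lambda> c / \<pi>0(a | x) \<ge> 0\<close>. For a policy \<open>\<pi>\<close> the estimator satisfies
  \<open>- \<lambda> n R\<^sub>n(\<pi>) = \<Sum> \<pi>(a | x) ln (1 + y)\<close>, and \<open>exp (t u) \<le> 1 + t (exp u - 1)\<close> for \<open>t \<in> [0, 1]\<close> gives
  \<open>(1 + y)^\<pi> \<le> 1 + \<pi> y\<close> and \<open>(1 + y)^(-\<pi>) \<le> 1 - \<pi> y / (1 + y)\<close>. Here \<open>E[\<pi> y] \<le> - \<lambda> R(\<pi>)\<close> since costs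
  are nonpositive, with equality under coverage, and then
  \<open>E[\<pi> y / (1 + y)] = - \<lambda> R(\<pi>) - \<lambda>\<^sup>2 S(\<pi>)\<close>. Hence both \<open>exp (\<lambda> n (R - R\<^sub>n))\<close> and
  \<open>exp (\<lambda> n (R\<^sub>n - R - \<lambda> S))\<close> have expectation at most 1. The first, applied to each predictor and
  averaged over the prior, yields an upper bound on \<open>R\<close> uniform in \<open>Q\<close>; the second is used only for
  \<open>Q*\<close>; optimality of the minimiser links the two.
\<close>

section \<open>Exponential moments, Markov's inequality and relative entropy\<close>

lemma exp_mult_le_affine:
  fixes t u :: real
  assumes "0 \<le> t" "t \<le> 1"
  shows "exp (t * u) \<le> 1 + t * (exp u - 1)"
  using convex_onD[OF exp_convex assms(1,2), of 0 u]
  by (simp add: algebra_simps)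

text \<open>Chernoff's argument: one coordinate has exponential moment at most 1 + b \<le> exp b,
  and independence turns the moment of the sum into a power of this factor. The extended integral is
  used because integrability is known for \<open>\<psi>\<close> but not in advance for
  \<open>exp (\<phi> z)\<close>.\<close>

lemma nn_integral_exp_sum_PiM_le_1:
  fixes \<phi> \<psi> :: "'a \<Rightarrow> real"
  assumes "prob_space M" "finite I"
    and \<phi>[measurable]: "\<phi> \<in> borel_measurable M"
    and \<psi>: "integrable M \<psi>"
    and le: "\<And>z. z \<in> space M \<Longrightarrow> exp (\<phi> z) \<le> 1 + \<psi> z"
    and b: "integral\<^sup>L M \<psi> \<le> b"
  shows "(\<integral>\<^sup>+ D. ennreal (exp ((\<Sum>i\<in>I. \<phi> (D i)) - real (card I) * b)) \<partial>PiM I (\<lambda>_. M)) \<le> 1"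
proof -
  interpret prob_space M by fact
  interpret PS: product_sigma_finite "\<lambda>_. M" by standard
  \<comment> \<open>In one application \<open>\<psi>\<close> is negative. As 1 + \<psi> dominates an
    exponential, it is still nonnegative, and its extended integral is the Bochner integral.\<close>
  have [simp]: "0 \<le> 1 + \<psi> z" if "z \<in> space M" for z
    using le[OF that] exp_ge_zero[of "\<phi> z"] by linarith
  have "(\<integral>\<^sup>+ z. ennreal (exp (\<phi> z)) \<partial>M) \<le> (\<integral>\<^sup>+ z. ennreal (1 + \<psi> z) \<partial>M)"
    by (intro nn_integral_mono ennreal_leI le)
  also have "\<dots> = ennreal (\<integral> z. 1 + \<psi> z \<partial>M)"
    using \<psi> by (intro nn_integral_eq_integral AE_I2) auto
  also have "(\<integral> z. 1 + \<psi> z \<partial>M) = 1 + integral\<^sup>L M \<psi>"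
    using \<psi> by (simp add: prob_space)
  also have "ennreal \<dots> \<le> ennreal (exp b)"
    using b exp_ge_add_one_self[of b] by (intro ennreal_leI) linarith
  finally have one: "(\<integral>\<^sup>+ z. ennreal (exp (\<phi> z)) \<partial>M) \<le> ennreal (exp b)" .
  have "(\<integral>\<^sup>+ D. ennreal (exp ((\<Sum>i\<in>I. \<phi> (D i)) - real (card I) * b)) \<partial>PiM I (\<lambda>_. M))
      = (\<integral>\<^sup>+ D. (\<Prod>i\<in>I. ennreal (exp (\<phi> (D i)))) * ennreal (exp (- real (card I) * b)) \<partial>PiM I (\<lambda>_. M))"
    using \<open>finite I\<close>
    by (simp add: exp_diff exp_sum prod_ennreal ennreal_mult[symmetric] prod_nonneg exp_minus divide_simps)
  also have "\<dots> = (\<integral>\<^sup>+ D. (\<Prod>i\<in>I. ennreal (exp (\<phi> (D i)))) \<partial>PiM I (\<lambda>_. M)) * ennreal (exp (- real (card I) * b))"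
    by (intro nn_integral_multc) measurable
  also have "(\<integral>\<^sup>+ D. (\<Prod>i\<in>I. ennreal (exp (\<phi> (D i)))) \<partial>PiM I (\<lambda>_. M)) = (\<integral>\<^sup>+ z. ennreal (exp (\<phi> z)) \<partial>M) ^ card I"
    using \<open>finite I\<close> by (subst PS.product_nn_integral_prod) auto
  also have "\<dots> * ennreal (exp (- real (card I) * b)) \<le> ennreal (exp b) ^ card I * ennreal (exp (- real (card I) * b))"
    by (intro mult_right_mono power_mono one) auto
  also have "\<dots> = 1"
    by (simp add: ennreal_power ennreal_mult[symmetric] exp_of_nat_mult[symmetric] exp_add[symmetric])
  finally show ?thesis .
qed

text \<open>Markov's inequality for the complement, on which \<open>ennreal \<epsilon> * u z\<close>
  is at least 1. Values in \<open>ennreal\<close> allow \<open>u\<close> to be itself an extended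
  integral, such as an average over the prior.\<close>

lemma (in prob_space) prob_le_inverse_ge:
  assumes [measurable]: "u \<in> borel_measurable M"
    and u: "(\<integral>\<^sup>+ z. u z \<partial>M) \<le> 1" and \<epsilon>: "0 < \<epsilon>"
  shows "prob {z \<in> space M. u z \<le> ennreal (1 / \<epsilon>)} \<ge> 1 - \<epsilon>"
proof -
  let ?A = "{z \<in> space M. u z \<le> ennreal (1 / \<epsilon>)}"
  have "emeasure M (space M - ?A) \<le> emeasure M {z \<in> space M. 1 \<le> ennreal \<epsilon> * u z}"
  proof (intro emeasure_mono subsetI; clarsimp)
    fix z assume "\<not> u z \<le> ennreal (1 / \<epsilon>)"
    then have "ennreal \<epsilon> * ennreal (1 / \<epsilon>) \<le> ennreal \<epsilon> * u z"
      by (intro mult_left_mono) auto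
    then show "1 \<le> ennreal \<epsilon> * u z"
      using \<epsilon> by (simp add: ennreal_mult[symmetric])
  qed
  also have "\<dots> \<le> ennreal \<epsilon> * (\<integral>\<^sup>+ z. u z * indicator (space M) z \<partial>M)"
    using nn_integral_Markov_inequality[of u "space M" M "ennreal \<epsilon>"] by simp
  also have "(\<integral>\<^sup>+ z. u z * indicator (space M) z \<partial>M) = (\<integral>\<^sup>+ z. u z \<partial>M)"
    by (intro nn_integral_cong) simp
  also have "ennreal \<epsilon> * \<dots> \<le> ennreal \<epsilon> * 1"
    by (rule mult_left_mono[OF u]) simp
  finally have "prob (space M - ?A) \<le> \<epsilon>"
    using \<epsilon> by (simp add: emeasure_eq_measure)
  then show ?thesis
    by (subst (asm) prob_compl) auto
qed

text \<open>
  The Donsker--Varadhan inequality, obtained by integrating \<open>u \<le> exp u - 1\<close> at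
  \<open>u = h - ln (dQ/dP) - ln C\<close> against \<open>Q\<close>.
\<close>

lemma donsker_varadhan:
  fixes h :: "'a \<Rightarrow> real"
  assumes P: "prob_space P" and Q: "prob_space Q" and sets: "sets Q = sets P"
    and ac: "absolutely_continuous P Q"
    and int: "integrable Q (entropy_density (exp 1) P Q)"
    and h: "integrable Q h"
    and C: "(\<integral>\<^sup>+ \<theta>. ennreal (exp (h \<theta>)) \<partial>P) \<le> ennreal C" and "0 < C"
  shows "integral\<^sup>L Q h \<le> KL_divergence (exp 1) P Q + ln C"
proof -
  interpret P: prob_space P by fact
  interpret Q: prob_space Q by fact
  define g where "g = (\<lambda>\<theta>. enn2real (RN_deriv P Q \<theta>))"
  have [measurable]: "g \<in> borel_measurable P" unfolding g_def by simp
  have hP[measurable]: "h \<in> borel_measurable P"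
    using h sets by (auto dest!: borel_measurable_integrable cong: measurable_cong_sets)
  have "AE \<theta> in P. RN_deriv P Q \<theta> \<noteq> \<infinity>"
    using P.RN_deriv_finite[OF Q.sigma_finite_measure_axioms ac sets] .
  then have fin: "AE \<theta> in P. RN_deriv P Q \<theta> = ennreal (g \<theta>)"
    by eventually_elim (simp add: g_def less_top)
  have dens: "Q = density P (\<lambda>\<theta>. ennreal (g \<theta>))"
    using P.density_RN_deriv[OF ac sets] fin density_cong[of "RN_deriv P Q" P "\<lambda>\<theta>. ennreal (g \<theta>)"]
    by simp
  \<comment> \<open>\<open>Q\<close> has density \<open>g\<close> with respect to \<open>P\<close>,
    so it gives no mass to the zeros of \<open>g\<close>; the logarithm of \<open>g\<close> is thus
    taken at positive arguments for \<open>Q\<close>-almost every parameter.\<close>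
  have pos: "AE \<theta> in Q. 0 < g \<theta>"
    by (subst dens, subst AE_density) (auto simp: ennreal_zero_less_mult_iff)
  have ed: "entropy_density (exp 1) P Q = (\<lambda>\<theta>. ln (g \<theta>))"
    by (auto simp: entropy_density_def g_def log_def)
  let ?v = "\<lambda>\<theta>. exp (h \<theta>) / (g \<theta> * C)"
  have "(\<integral>\<^sup>+ \<theta>. ennreal (?v \<theta>) \<partial>Q) = (\<integral>\<^sup>+ \<theta>. ennreal (g \<theta>) * ennreal (?v \<theta>) \<partial>P)"
    by (subst dens, subst nn_integral_density) auto
  \<comment> \<open>The factor \<open>g\<close> cancels where it is positive. Where it vanishes the
    left integrand is 0, so in general only an inequality holds.\<close>
  also have "\<dots> \<le> (\<integral>\<^sup>+ \<theta>. ennreal (exp (h \<theta>)) * ennreal (1 / C) \<partial>P)"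
    using \<open>0 < C\<close>
    by (intro nn_integral_mono)
       (auto simp: ennreal_mult[symmetric] g_def intro!: ennreal_leI)
  also have "\<dots> \<le> ennreal C * ennreal (1 / C)"
    by (subst nn_integral_multc) (auto intro!: mult_right_mono C)
  also have "\<dots> = 1"
    using \<open>0 < C\<close> by (simp add: ennreal_mult[symmetric])
  finally have v1: "(\<integral>\<^sup>+ \<theta>. ennreal (?v \<theta>) \<partial>Q) \<le> 1" .
  have v0: "0 \<le> ?v \<theta>" for \<theta> using \<open>0 < C\<close> by (simp add: g_def)
  have vm: "?v \<in> borel_measurable Q"
    unfolding measurable_cong_sets[OF sets refl] by measurable
  have vint: "integrable Q ?v"
    using v1 v0 vm by (intro integrableI_nonneg AE_I2) (auto intro: le_less_trans)
  have vle: "integral\<^sup>L Q ?v \<le> 1"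
    using v1 nn_integral_eq_integral[OF vint AE_I2] v0 by simp
  have "integral\<^sup>L Q (\<lambda>\<theta>. h \<theta> - ln (g \<theta>) - ln C) \<le> integral\<^sup>L Q (\<lambda>\<theta>. ?v \<theta> - 1)"
  proof (rule integral_mono_AE)
    show "AE \<theta> in Q. h \<theta> - ln (g \<theta>) - ln C \<le> ?v \<theta> - 1"
      using pos
    proof eventually_elim
      case (elim \<theta>)
      then have "exp (h \<theta> - ln (g \<theta>) - ln C) = ?v \<theta>"
        using \<open>0 < C\<close> by (simp add: exp_diff)
      then show ?case
        using exp_ge_add_one_self[of "h \<theta> - ln (g \<theta>) - ln C"] by simp
    qed
  qed (use h int vint in \<open>auto simp: ed\<close>)
  then have "integral\<^sup>L Q h - KL_divergence (exp 1) P Q - ln C \<le> integral\<^sup>L Q ?v - 1"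
    using h int vint by (simp add: KL_divergence_def ed Q.prob_space)
  with vle show ?thesis by simp
qed

section \<open>The logged bandit model: policies, costs and risk\<close>

locale logged_bandit =
  fixes X :: "(real ^ 'd) set" and K :: nat
    and \<nu> :: "(real ^ 'd) measure"
    and \<pi>0 :: "'d policy"
    and p :: "real ^ 'd \<Rightarrow> nat \<Rightarrow> real measure"
  assumes context_dist: "\<nu> \<in> space (prob_algebra (context_space X))"
    and behavior_policy: "is_policy X K \<pi>0"
    and cost_kernel: "(\<lambda>(x, a). p x a) \<in> context_space X \<Otimes>\<^sub>M action_space K \<rightarrow>\<^sub>M prob_algebra cost_space"
begin

lemma space_context: "space (context_space X) = X"
  by (simp add: context_space_def space_restrict_space)

lemma space_action: "space (action_space K) = {1..K}"
  by (simp add: action_space_def)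

lemma sets_\<nu>[measurable_cong]: "sets \<nu> = sets (context_space X)"
  using context_dist by (simp add: space_prob_algebra)

lemma space_\<nu>: "space \<nu> = X"
  using sets_eq_imp_space_eq[OF sets_\<nu>] by (simp add: space_context)

lemma prob_space_\<nu>: "prob_space \<nu>"
  using context_dist by (simp add: space_prob_algebra)

text \<open>There are finitely many actions, so measurability for each fixed action, which is the
  form that \<open>is_policy\<close> provides, implies measurability when the action varies with the
  point.\<close>

lemma measurable_action_apply:
  assumes "\<And>a. a \<in> {1..K} \<Longrightarrow> (\<lambda>z. h z a) \<in> M \<rightarrow>\<^sub>M N" "g \<in> M \<rightarrow>\<^sub>M action_space K"
  shows "(\<lambda>z. h z (g z)) \<in> M \<rightarrow>\<^sub>M N"
  using measurable_compose_countable'[of "{1..K}" "\<lambda>a z. h z a" M N g] assms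
  by (auto simp: action_space_def)

lemma policy_nonneg: "is_policy X K \<pi> \<Longrightarrow> x \<in> X \<Longrightarrow> a \<in> {1..K} \<Longrightarrow> 0 \<le> \<pi> x a"
  by (auto simp: is_policy_def)

lemma policy_le_1:
  assumes "is_policy X K \<pi>" "x \<in> X" "a \<in> {1..K}" shows "\<pi> x a \<le> 1"
proof -
  have "\<pi> x a \<le> (\<Sum>b\<in>{1..K}. \<pi> x b)"
    using assms by (intro member_le_sum) (auto simp: is_policy_def)
  with assms show ?thesis by (auto simp: is_policy_def)
qed

lemma policy_measurable:
  "is_policy X K \<pi> \<Longrightarrow> a \<in> {1..K} \<Longrightarrow> (\<lambda>x. \<pi> x a) \<in> borel_measurable (context_space X)"
  by (auto simp: is_policy_def)

lemma policy_measurable_compose: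
  assumes \<pi>: "is_policy X K \<pi>"
    and u: "u \<in> M \<rightarrow>\<^sub>M context_space X" and g: "g \<in> M \<rightarrow>\<^sub>M action_space K"
  shows "(\<lambda>z. \<pi> (u z) (g z)) \<in> borel_measurable M"
  by (rule measurable_action_apply[OF measurable_compose[OF u policy_measurable[OF \<pi>]] g])

lemma action_dist_kernel:
  assumes \<pi>: "is_policy X K \<pi>"
  shows "action_dist K \<pi> \<in> context_space X \<rightarrow>\<^sub>M prob_algebra (action_space K)"
proof (intro measurable_prob_algebraI measurable_subprob_algebra)
  fix x assume "x \<in> space (context_space X)"
  then have x: "x \<in> X" by (simp add: space_context)
  have "(\<Sum>a\<in>{1..K}. ennreal (\<pi> x a)) = ennreal (\<Sum>a\<in>{1..K}. \<pi> x a)"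
    by (intro sum_ennreal policy_nonneg[OF \<pi> x])
  also have "\<dots> = 1"
    using \<pi> x by (simp add: is_policy_def)
  finally show *: "prob_space (action_dist K \<pi> x)"
    by (intro prob_spaceI)
       (simp add: action_dist_def space_point_measure emeasure_point_measure_finite)
  then show "subprob_space (action_dist K \<pi> x)"
    by (rule prob_space_imp_subprob_space)
  show "sets (action_dist K \<pi> x) = sets (action_space K)"
    by (simp add: action_dist_def action_space_def sets_point_measure)
next
  fix A assume "A \<in> sets (action_space K)"
  then have A: "A \<subseteq> {1..K}" by (simp add: action_space_def)
  then have "(\<lambda>x. \<Sum>a\<in>A. ennreal (\<pi> x a)) \<in> borel_measurable (context_space X)"
    by (intro borel_measurable_sum measurable_compose[OF policy_measurable measurable_ennreal] \<pi>) auto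
  then show "(\<lambda>x. emeasure (action_dist K \<pi> x) A) \<in> borel_measurable (context_space X)"
    using A by (simp add: action_dist_def emeasure_point_measure_finite)
qed

lemma nn_integral_action_dist:
  "(\<integral>\<^sup>+ a. g a \<partial>action_dist K \<pi> x) = (\<Sum>a\<in>{1..K}. ennreal (\<pi> x a) * g a)"
  unfolding action_dist_def by (rule nn_integral_point_measure_finite) simp

lemma cost_kernel_at: "a \<in> {1..K} \<Longrightarrow> (\<lambda>x. p x a) \<in> context_space X \<rightarrow>\<^sub>M prob_algebra cost_space"
  using measurable_compose[OF measurable_Pair2'[of a "action_space K" "context_space X"] cost_kernel]
  by (simp only: space_action case_prod_conv)

lemma
  assumes "x \<in> X" "a \<in> {1..K}"
  shows prob_space_cost: "prob_space (p x a)"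
    and sets_cost: "sets (p x a) = sets cost_space"
    and space_cost: "space (p x a) = {-1..0}"
proof -
  have *: "p x a \<in> space (prob_algebra cost_space)"
    using measurable_space[OF cost_kernel_at[OF assms(2)], of x] assms(1) by (simp add: space_context)
  then show "prob_space (p x a)" and sets: "sets (p x a) = sets cost_space"
    by (simp_all add: space_prob_algebra)
  show "space (p x a) = {-1..0}"
    unfolding sets_eq_imp_space_eq[OF sets] by (simp add: cost_space_def space_restrict_space)
qed

lemma cost_measurable[measurable]: "(\<lambda>c. c) \<in> borel_measurable cost_space"
  unfolding cost_space_def by (rule measurable_restrict_space1) simp

lemma integrable_cost:
  assumes "x \<in> X" "a \<in> {1..K}"
  shows "integrable (p x a) (\<lambda>c. c)"
proof -
  interpret prob_space "p x a" by (rule prob_space_cost[OF assms])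
  show ?thesis
    using space_cost[OF assms] measurable_cong_sets[OF sets_cost[OF assms] refl, of borel]
    by (intro integrable_const_bound[where B=1] AE_I2) auto
qed

lemma mean_cost_bounds:
  assumes "x \<in> X" "a \<in> {1..K}"
  shows "-1 \<le> mean_cost p x a" "mean_cost p x a \<le> 0"
proof -
  interpret prob_space "p x a" by (rule prob_space_cost[OF assms])
  note int = integrable_cost[OF assms]
  show "-1 \<le> mean_cost p x a"
    unfolding mean_cost_def using space_cost[OF assms]
    by (intro integral_ge_const int AE_I2) auto
  show "mean_cost p x a \<le> 0"
    unfolding mean_cost_def using space_cost[OF assms]
    by (intro integral_le_const int AE_I2) auto
qed

text \<open>Costs are nonpositive, so \<open>r * - c\<close> is nonnegative and both kinds of
  integral agree. Later \<open>r\<close> is the importance weight times \<open>lam\<close>.\<close>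

lemma nn_integral_neg_cost:
  assumes "x \<in> X" "a \<in> {1..K}" "0 \<le> r"
  shows "(\<integral>\<^sup>+ c. ennreal (r * - c) \<partial>p x a) = ennreal (r * - mean_cost p x a)"
proof -
  have "(\<integral>\<^sup>+ c. ennreal (r * - c) \<partial>p x a) = ennreal (\<integral> c. r * - c \<partial>p x a)"
    using integrable_cost[OF assms(1,2)] assms(3) space_cost[OF assms(1,2)]
    by (intro nn_integral_eq_integral AE_I2) (auto intro!: mult_nonneg_nonpos)
  also have "(\<integral> c. r * - c \<partial>p x a) = r * - mean_cost p x a"
    by (simp add: mean_cost_def)
  finally show ?thesis .
qed

lemma mean_cost_measurable:
  assumes "a \<in> {1..K}"
  shows "(\<lambda>x. mean_cost p x a) \<in> borel_measurable (context_space X)"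
  unfolding mean_cost_def
  by (rule measurable_compose[OF measurable_prob_algebraD[OF cost_kernel_at[OF assms]]
        integral_measurable_subprob_algebra]) simp

text \<open>The assumption is nonnegativity of the weights, so that the identity can be rewritten
  with for predictor policies at every parameter, also outside the parameter space.\<close>

lemma risk_eq:
  assumes \<pi>: "\<And>x a. x \<in> X \<Longrightarrow> a \<in> {1..K} \<Longrightarrow> 0 \<le> \<pi> x a"
  shows "risk K \<nu> p \<pi> = (\<integral> x. (\<Sum>a\<in>{1..K}. \<pi> x a * mean_cost p x a) \<partial>\<nu>)"
  unfolding risk_def action_dist_def
  by (intro Bochner_Integration.integral_cong refl, subst lebesgue_integral_point_measure_finite)
     (auto simp: space_\<nu> \<pi>)

lemma risk_policy_eq:
  "is_policy X K \<pi> \<Longrightarrow> risk K \<nu> p \<pi> = (\<integral> x. (\<Sum>a\<in>{1..K}. \<pi> x a * mean_cost p x a) \<partial>\<nu>)"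
  by (intro risk_eq policy_nonneg)

lemma policy_mean_cost_bounds:
  assumes \<pi>: "is_policy X K \<pi>" and x: "x \<in> X"
  shows "-1 \<le> (\<Sum>a\<in>{1..K}. \<pi> x a * mean_cost p x a)"
    and "(\<Sum>a\<in>{1..K}. \<pi> x a * mean_cost p x a) \<le> 0"
proof -
  have "(\<Sum>a\<in>{1..K}. \<pi> x a * - 1) \<le> (\<Sum>a\<in>{1..K}. \<pi> x a * mean_cost p x a)"
    using mean_cost_bounds[OF x] policy_nonneg[OF \<pi> x] by (intro sum_mono mult_left_mono) auto
  then show "-1 \<le> (\<Sum>a\<in>{1..K}. \<pi> x a * mean_cost p x a)"
    using \<pi> x by (simp add: is_policy_def sum_negf)
  show "(\<Sum>a\<in>{1..K}. \<pi> x a * mean_cost p x a) \<le> 0"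
    using mean_cost_bounds[OF x] policy_nonneg[OF \<pi> x]
    by (intro sum_nonpos mult_nonneg_nonpos) auto
qed

lemma integrable_policy_mean_cost:
  assumes \<pi>: "is_policy X K \<pi>"
  shows "integrable \<nu> (\<lambda>x. \<Sum>a\<in>{1..K}. \<pi> x a * mean_cost p x a)"
proof -
  interpret prob_space \<nu> by (rule prob_space_\<nu>)
  have "(\<lambda>x. \<Sum>a\<in>{1..K}. \<pi> x a * mean_cost p x a) \<in> borel_measurable \<nu>"
    unfolding measurable_cong_sets[OF sets_\<nu> refl]
    by (intro borel_measurable_sum borel_measurable_times policy_measurable mean_cost_measurable \<pi>)
  moreover have "AE x in \<nu>. norm (\<Sum>a\<in>{1..K}. \<pi> x a * mean_cost p x a) \<le> 1"
    using policy_mean_cost_bounds[OF \<pi>] by (intro AE_I2) (simp add: space_\<nu> abs_le_iff)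
  ultimately show ?thesis by (intro integrable_const_bound)
qed

lemma risk_bounds:
  assumes \<pi>: "is_policy X K \<pi>"
  shows "-1 \<le> risk K \<nu> p \<pi>" "risk K \<nu> p \<pi> \<le> 0"
proof -
  interpret prob_space \<nu> by (rule prob_space_\<nu>)
  note int = integrable_policy_mean_cost[OF \<pi>]
  note eq = risk_policy_eq[OF \<pi>]
  show "-1 \<le> risk K \<nu> p \<pi>"
    unfolding eq
    by (rule integral_ge_const[OF int AE_I2]) (rule policy_mean_cost_bounds(1)[OF \<pi>], simp only: space_\<nu>)
  show "risk K \<nu> p \<pi> \<le> 0"
    unfolding eq
    by (rule integral_le_const[OF int AE_I2]) (rule policy_mean_cost_bounds(2)[OF \<pi>], simp only: space_\<nu>)
qed

text \<open>Extended-integral form of the negated risk. The factor \<open>r\<close> stands inside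
  each summand to match the shape of \<open>nn_integral_weight_ratio\<close>.\<close>

lemma nn_integral_neg_risk:
  assumes \<pi>: "is_policy X K \<pi>" and "0 \<le> r"
  shows "(\<integral>\<^sup>+ x. (\<Sum>a\<in>{1..K}. ennreal (r * \<pi> x a * - mean_cost p x a)) \<partial>\<nu>) = ennreal (- r * risk K \<nu> p \<pi>)"
proof -
  let ?s = "\<lambda>x. \<Sum>a\<in>{1..K}. \<pi> x a * mean_cost p x a"
  have "(\<integral>\<^sup>+ x. (\<Sum>a\<in>{1..K}. ennreal (r * \<pi> x a * - mean_cost p x a)) \<partial>\<nu>)
      = (\<integral>\<^sup>+ x. ennreal (- r * ?s x) \<partial>\<nu>)"
  proof (rule nn_integral_cong)
    fix x assume "x \<in> space \<nu>"
    then have x: "x \<in> X" by (simp add: space_\<nu>)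
    have "0 \<le> r * \<pi> x a * - mean_cost p x a" if "a \<in> {1..K}" for a
      using mean_cost_bounds(2)[OF x that] policy_nonneg[OF \<pi> x that] \<open>0 \<le> r\<close>
      by (intro mult_nonneg_nonneg) linarith+
    then have "(\<Sum>a\<in>{1..K}. ennreal (r * \<pi> x a * - mean_cost p x a)) = ennreal (\<Sum>a\<in>{1..K}. r * \<pi> x a * - mean_cost p x a)"
      by (rule sum_ennreal)
    also have "(\<Sum>a\<in>{1..K}. r * \<pi> x a * - mean_cost p x a) = - r * ?s x"
      unfolding sum_distrib_left by (intro sum.cong refl) (simp only: algebra_simps)
    finally show "(\<Sum>a\<in>{1..K}. ennreal (r * \<pi> x a * - mean_cost p x a)) = ennreal (- r * ?s x)" .
  qed
  also have "\<dots> = ennreal (\<integral> x. - r * ?s x \<partial>\<nu>)"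
  proof (rule nn_integral_eq_integral)
    show "integrable \<nu> (\<lambda>x. - r * ?s x)"
      by (intro integrable_mult_right integrable_policy_mean_cost \<pi>)
    show "AE x in \<nu>. 0 \<le> - r * ?s x"
    proof (rule AE_I2)
      fix x assume "x \<in> space \<nu>"
      then have "?s x \<le> 0" by (intro policy_mean_cost_bounds(2)[OF \<pi>]) (simp only: space_\<nu>)
      with \<open>0 \<le> r\<close> show "0 \<le> - r * ?s x" by (intro mult_nonpos_nonpos) linarith+
    qed
  qed
  also have "(\<integral> x. - r * ?s x \<partial>\<nu>) = - r * risk K \<nu> p \<pi>"
    unfolding risk_policy_eq[OF \<pi>] by (rule integral_mult_right_zero)
  finally show ?thesis .
qed

section \<open>The law of one logged tuple\<close>

abbreviation logs :: "((real ^ 'd) \<times> nat \<times> real) measure" where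
  "logs \<equiv> log_dist X K \<nu> \<pi>0 p"

text \<open>Joint measurability of the cost stage in context and action is what allows the nested
  binds of \<open>log_dist\<close> to be unfolded.\<close>

lemma log_inner_kernel:
  "(\<lambda>(x, a). p x a \<bind> (\<lambda>c. return (log_space X K) (x, a, c)))
     \<in> context_space X \<Otimes>\<^sub>M action_space K \<rightarrow>\<^sub>M prob_algebra (log_space X K)"
proof -
  have "(\<lambda>z. p (fst z) (snd z) \<bind> (\<lambda>c. return (log_space X K) (fst z, snd z, c)))
     \<in> context_space X \<Otimes>\<^sub>M action_space K \<rightarrow>\<^sub>M prob_algebra (log_space X K)"
  proof (rule measurable_bind_prob_space2)
    show "(\<lambda>z. p (fst z) (snd z)) \<in> context_space X \<Otimes>\<^sub>M action_space K \<rightarrow>\<^sub>M prob_algebra cost_space"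
      using cost_kernel unfolding case_prod_beta' .
    show "(\<lambda>(z, c). return (log_space X K) (fst z, snd z, c))
        \<in> (context_space X \<Otimes>\<^sub>M action_space K) \<Otimes>\<^sub>M cost_space \<rightarrow>\<^sub>M prob_algebra (log_space X K)"
      unfolding case_prod_beta' log_space_def
      by (rule measurable_compose[OF _ measurable_return_prob_space]) measurable
  qed
  then show ?thesis unfolding case_prod_beta' .
qed

lemma log_kernel:
  "(\<lambda>x. action_dist K \<pi>0 x \<bind> (\<lambda>a. p x a \<bind> (\<lambda>c. return (log_space X K) (x, a, c))))
     \<in> context_space X \<rightarrow>\<^sub>M prob_algebra (log_space X K)"
  by (rule measurable_bind_prob_space2[OF action_dist_kernel[OF behavior_policy] log_inner_kernel])

lemma logs_in_prob_algebra: "logs \<in> space (prob_algebra (log_space X K))"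
proof -
  have "(\<lambda>\<mu>. \<mu> \<bind> (\<lambda>x. action_dist K \<pi>0 x \<bind> (\<lambda>a. p x a \<bind> (\<lambda>c. return (log_space X K) (x, a, c)))))
      \<in> prob_algebra (context_space X) \<rightarrow>\<^sub>M prob_algebra (log_space X K)"
    by (rule measurable_bind_prob_space[OF measurable_ident log_kernel, unfolded id_def])
  from measurable_space[OF this context_dist] show ?thesis
    by (simp add: log_dist_def)
qed

lemma prob_space_logs: "prob_space logs"
  and sets_logs[measurable_cong]: "sets logs = sets (log_space X K)"
  using logs_in_prob_algebra by (auto simp: space_prob_algebra)

lemma space_logs: "space logs = X \<times> {1..K} \<times> {-1..0}"
  using sets_eq_imp_space_eq[OF sets_logs]
  by (simp add: log_space_def space_pair_measure space_context space_action cost_space_def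
      space_restrict_space)

text \<open>The three sampling stages are unfolded one bind at a time, the action stage being a
  finite sum. The extended integral suits integrands that are unbounded because of division by
  \<open>\<pi>0\<close>.\<close>

lemma nn_integral_logs:
  assumes g: "g \<in> borel_measurable (log_space X K)"
  shows "(\<integral>\<^sup>+ z. g z \<partial>logs)
    = (\<integral>\<^sup>+ x. (\<Sum>a\<in>{1..K}. ennreal (\<pi>0 x a) * (\<integral>\<^sup>+ c. g (x, a, c) \<partial>p x a)) \<partial>\<nu>)"
proof -
  let ?k = "\<lambda>x a. p x a \<bind> (\<lambda>c. return (log_space X K) (x, a, c))"
  have "(\<integral>\<^sup>+ z. g z \<partial>logs) = (\<integral>\<^sup>+ x. \<integral>\<^sup>+ z. g z \<partial>(action_dist K \<pi>0 x \<bind> ?k x) \<partial>\<nu>)"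
    unfolding log_dist_def using measurable_prob_algebraD[OF log_kernel]
    by (intro nn_integral_bind[OF g]) (simp add: measurable_cong_sets[OF sets_\<nu> refl])
  also have "\<dots> = (\<integral>\<^sup>+ x. (\<Sum>a\<in>{1..K}. ennreal (\<pi>0 x a) * (\<integral>\<^sup>+ c. g (x, a, c) \<partial>p x a)) \<partial>\<nu>)"
  proof (rule nn_integral_cong)
    fix x assume "x \<in> space \<nu>"
    then have x: "x \<in> X" by (simp add: space_\<nu>)
    have sa: "sets (action_dist K \<pi>0 x) = sets (action_space K)"
      by (simp add: action_dist_def action_space_def sets_point_measure)
    have kx: "?k x \<in> action_dist K \<pi>0 x \<rightarrow>\<^sub>M subprob_algebra (log_space X K)"
      unfolding measurable_cong_sets[OF sa refl]
      using measurable_compose[OF measurable_Pair1'[of x "context_space X" "action_space K"]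
          measurable_prob_algebraD[OF log_inner_kernel]] x
      by (simp add: space_context)
    have "(\<integral>\<^sup>+ z. g z \<partial>(action_dist K \<pi>0 x \<bind> ?k x)) = (\<integral>\<^sup>+ a. \<integral>\<^sup>+ z. g z \<partial>?k x a \<partial>action_dist K \<pi>0 x)"
      by (rule nn_integral_bind[OF g kx])
    also have "\<dots> = (\<Sum>a\<in>{1..K}. ennreal (\<pi>0 x a) * (\<integral>\<^sup>+ z. g z \<partial>?k x a))"
      by (rule nn_integral_action_dist)
    also have "\<dots> = (\<Sum>a\<in>{1..K}. ennreal (\<pi>0 x a) * (\<integral>\<^sup>+ c. g (x, a, c) \<partial>p x a))"
    proof (intro sum.cong refl arg_cong2[where f="(*)"])
      fix a assume a: "a \<in> {1..K}"
      have pr: "(\<lambda>c. (x, a, c)) \<in> cost_space \<rightarrow>\<^sub>M log_space X K"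
        using x a unfolding log_space_def
        by (intro measurable_Pair measurable_const measurable_ident_sets refl)
           (auto simp: space_context space_action)
      have rk: "(\<lambda>c. return (log_space X K) (x, a, c)) \<in> p x a \<rightarrow>\<^sub>M subprob_algebra (log_space X K)"
        unfolding measurable_cong_sets[OF sets_cost[OF x a] refl]
        by (rule measurable_compose[OF pr return_measurable])
      have "(\<integral>\<^sup>+ z. g z \<partial>?k x a) = (\<integral>\<^sup>+ c. \<integral>\<^sup>+ z. g z \<partial>return (log_space X K) (x, a, c) \<partial>p x a)"
        by (rule nn_integral_bind[OF g rk])
      also have "\<dots> = (\<integral>\<^sup>+ c. g (x, a, c) \<partial>p x a)"
      proof (rule nn_integral_cong)
        fix c assume "c \<in> space (p x a)"
        then have "(x, a, c) \<in> space (log_space X K)"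
          using measurable_space[OF pr] sets_eq_imp_space_eq[OF sets_cost[OF x a]] by simp
        then show "(\<integral>\<^sup>+ z. g z \<partial>return (log_space X K) (x, a, c)) = g (x, a, c)"
          by (rule nn_integral_return[OF _ g])
      qed
      finally show "(\<integral>\<^sup>+ z. g z \<partial>?k x a) = (\<integral>\<^sup>+ c. g (x, a, c) \<partial>p x a)" .
    qed
    finally show "(\<integral>\<^sup>+ z. g z \<partial>(action_dist K \<pi>0 x \<bind> ?k x)) = (\<Sum>a\<in>{1..K}. ennreal (\<pi>0 x a) * (\<integral>\<^sup>+ c. g (x, a, c) \<partial>p x a))" .
  qed
  finally show ?thesis .
qed

section \<open>Importance-weighted moments of one tuple\<close>

abbreviation weight :: "'d policy \<Rightarrow> (real ^ 'd) \<times> nat \<times> real \<Rightarrow> real" where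
  "weight \<pi> z \<equiv> \<pi> (fst z) (fst (snd z))"

text \<open>This is the quantity y of the overview: 1 + y is the argument of the logarithm in the
  estimator. By the convention on division by zero it is 0 where \<open>\<pi>0\<close>
  vanishes.\<close>

definition ratio :: "real \<Rightarrow> (real ^ 'd) \<times> nat \<times> real \<Rightarrow> real" where
  "ratio lam z = - (lam * snd (snd z) / \<pi>0 (fst z) (fst (snd z)))"

lemma
  shows context_proj_measurable: "fst \<in> log_space X K \<rightarrow>\<^sub>M context_space X"
    and action_proj_measurable: "(\<lambda>z. fst (snd z)) \<in> log_space X K \<rightarrow>\<^sub>M action_space K"
    and cost_proj_measurable: "(\<lambda>z. snd (snd z)) \<in> borel_measurable (log_space X K)"
proof -
  show "fst \<in> log_space X K \<rightarrow>\<^sub>M context_space X"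
    and "(\<lambda>z. fst (snd z)) \<in> log_space X K \<rightarrow>\<^sub>M action_space K"
    unfolding log_space_def by measurable
  have "(\<lambda>z. snd (snd z)) \<in> log_space X K \<rightarrow>\<^sub>M cost_space"
    unfolding log_space_def by measurable
  from measurable_compose[OF this cost_measurable]
  show "(\<lambda>z. snd (snd z)) \<in> borel_measurable (log_space X K)" .
qed

lemma weight_measurable:
  "is_policy X K \<pi> \<Longrightarrow> weight \<pi> \<in> borel_measurable (log_space X K)"
  by (rule policy_measurable_compose[OF _ context_proj_measurable action_proj_measurable])

lemma ratio_measurable: "ratio lam \<in> borel_measurable (log_space X K)"
  unfolding ratio_def
  by (intro borel_measurable_uminus borel_measurable_divide borel_measurable_times
      borel_measurable_const cost_proj_measurable weight_measurable behavior_policy)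

lemma weight_bounds:
  assumes "is_policy X K \<pi>" "z \<in> space logs"
  shows "0 \<le> weight \<pi> z" "weight \<pi> z \<le> 1"
  using assms policy_nonneg policy_le_1 by (auto simp: space_logs)

lemma ratio_nonneg:
  assumes "0 \<le> lam" "z \<in> space logs"
  shows "0 \<le> ratio lam z"
proof -
  have "0 \<le> lam * - snd (snd z) / weight \<pi>0 z"
    using assms weight_bounds(1)[OF behavior_policy assms(2)]
    by (intro divide_nonneg_nonneg mult_nonneg_nonneg) (auto simp: space_logs)
  then show ?thesis by (simp add: ratio_def)
qed

text \<open>Importance weighting: the probability \<open>\<pi>0 x a\<close> of sampling the action
  cancels the denominator of \<open>ratio\<close>. Actions that are never sampled contribute 0,
  hence the case distinction.\<close>

lemma nn_integral_weight_ratio: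
  assumes \<pi>: "is_policy X K \<pi>" and lam: "0 \<le> lam"
  shows "(\<integral>\<^sup>+ z. ennreal (weight \<pi> z * ratio lam z) \<partial>logs)
    = (\<integral>\<^sup>+ x. (\<Sum>a\<in>{1..K}. if 0 < \<pi>0 x a then ennreal (lam * \<pi> x a * - mean_cost p x a) else 0) \<partial>\<nu>)"
proof -
  have "(\<lambda>z. ennreal (weight \<pi> z * ratio lam z)) \<in> borel_measurable (log_space X K)"
    by (intro measurable_compose[OF _ measurable_ennreal] borel_measurable_times
        weight_measurable ratio_measurable \<pi>)
  from nn_integral_logs[OF this]
  have "(\<integral>\<^sup>+ z. ennreal (weight \<pi> z * ratio lam z) \<partial>logs)
    = (\<integral>\<^sup>+ x. (\<Sum>a\<in>{1..K}. ennreal (\<pi>0 x a) * (\<integral>\<^sup>+ c. ennreal (weight \<pi> (x, a, c) * ratio lam (x, a, c)) \<partial>p x a)) \<partial>\<nu>)" .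
  also have "\<dots> = (\<integral>\<^sup>+ x. (\<Sum>a\<in>{1..K}. if 0 < \<pi>0 x a then ennreal (lam * \<pi> x a * - mean_cost p x a) else 0) \<partial>\<nu>)"
  proof (intro nn_integral_cong sum.cong refl)
    fix x a assume "x \<in> space \<nu>" and a: "a \<in> {1..K}"
    then have x: "x \<in> X" by (simp add: space_\<nu>)
    show "ennreal (\<pi>0 x a) * (\<integral>\<^sup>+ c. ennreal (weight \<pi> (x, a, c) * ratio lam (x, a, c)) \<partial>p x a)
      = (if 0 < \<pi>0 x a then ennreal (lam * \<pi> x a * - mean_cost p x a) else 0)"
    proof (cases "0 < \<pi>0 x a")
      case False
      then show ?thesis by (simp add: ennreal_neg)
    next
      case True
      let ?r = "\<pi> x a * lam / \<pi>0 x a"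
      have r: "0 \<le> ?r"
        using True lam policy_nonneg[OF \<pi> x a] by simp
      have "(\<integral>\<^sup>+ c. ennreal (weight \<pi> (x, a, c) * ratio lam (x, a, c)) \<partial>p x a)
          = (\<integral>\<^sup>+ c. ennreal (?r * - c) \<partial>p x a)"
        by (simp add: ratio_def mult.assoc)
      also have "\<dots> = ennreal (?r * - mean_cost p x a)"
        by (rule nn_integral_neg_cost[OF x a r])
      finally show ?thesis
        using True by (simp add: ennreal_mult'[symmetric] mult.commute)
    qed
  qed
  finally show ?thesis .
qed

text \<open>Actions that \<open>\<pi>0\<close> never takes are missing from the left integral. Their
  terms in the negated risk are nonnegative, which gives the inequality; under coverage
  \<open>\<pi>\<close> gives them weight 0, which gives equality. The finite bound also proves
  integrability, although the ratio itself may be unbounded.\<close>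

lemma
  assumes \<pi>: "is_policy X K \<pi>" and lam: "0 \<le> lam"
  shows integrable_weight_ratio: "integrable logs (\<lambda>z. weight \<pi> z * ratio lam z)"
    and integral_weight_ratio_le: "(\<integral> z. weight \<pi> z * ratio lam z \<partial>logs) \<le> - lam * risk K \<nu> p \<pi>"
    and integral_weight_ratio_eq:
      "(AE x in \<nu>. \<forall>a\<in>{1..K}. \<pi> x a > 0 \<longrightarrow> \<pi>0 x a > 0) \<Longrightarrow>
        (\<integral> z. weight \<pi> z * ratio lam z \<partial>logs) = - lam * risk K \<nu> p \<pi>"
proof -
  let ?h = "\<lambda>z. weight \<pi> z * ratio lam z"
  let ?I = "\<integral>\<^sup>+ z. ennreal (?h z) \<partial>logs"
  have "?I \<le> (\<integral>\<^sup>+ x. (\<Sum>a\<in>{1..K}. ennreal (lam * \<pi> x a * - mean_cost p x a)) \<partial>\<nu>)"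
    unfolding nn_integral_weight_ratio[OF \<pi> lam]
    by (intro nn_integral_mono sum_mono) auto
  then have le: "?I \<le> ennreal (- lam * risk K \<nu> p \<pi>)"
    unfolding nn_integral_neg_risk[OF \<pi> lam] .
  have h0: "AE z in logs. 0 \<le> ?h z"
    by (intro AE_I2 mult_nonneg_nonneg weight_bounds \<pi> ratio_nonneg lam)
  have hm: "?h \<in> borel_measurable logs"
    unfolding measurable_cong_sets[OF sets_logs refl]
    by (intro borel_measurable_times weight_measurable ratio_measurable \<pi>)
  show int: "integrable logs ?h"
    using le_less_trans[OF le ennreal_less_top] by (intro integrableI_nonneg[OF hm h0]) simp
  have Ieq: "?I = ennreal (integral\<^sup>L logs ?h)"
    by (rule nn_integral_eq_integral[OF int h0])
  \<comment> \<open>\<open>ennreal\<close> maps negative reals to 0, so comparing the real values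
    requires their signs.\<close>
  have pos: "0 \<le> - lam * risk K \<nu> p \<pi>"
    using lam risk_bounds(2)[OF \<pi>] by (intro mult_nonpos_nonpos) auto
  show "integral\<^sup>L logs ?h \<le> - lam * risk K \<nu> p \<pi>"
    using le pos unfolding Ieq by simp
  assume cov: "AE x in \<nu>. \<forall>a\<in>{1..K}. \<pi> x a > 0 \<longrightarrow> \<pi>0 x a > 0"
  have "?I = (\<integral>\<^sup>+ x. (\<Sum>a\<in>{1..K}. ennreal (lam * \<pi> x a * - mean_cost p x a)) \<partial>\<nu>)"
    unfolding nn_integral_weight_ratio[OF \<pi> lam]
  proof (rule nn_integral_cong_AE)
    show "AE x in \<nu>. (\<Sum>a\<in>{1..K}. if 0 < \<pi>0 x a then ennreal (lam * \<pi> x a * - mean_cost p x a) else 0)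
        = (\<Sum>a\<in>{1..K}. ennreal (lam * \<pi> x a * - mean_cost p x a))"
      using cov AE_space
    proof eventually_elim
      case (elim x)
      then have "\<pi> x a = 0" if "a \<in> {1..K}" "\<not> 0 < \<pi>0 x a" for a
        using that policy_nonneg[OF \<pi>, of x a] by (force simp: space_\<nu>)
      then show ?case by (intro sum.cong) auto
    qed
  qed
  then have "ennreal (integral\<^sup>L logs ?h) = ennreal (- lam * risk K \<nu> p \<pi>)"
    unfolding nn_integral_neg_risk[OF \<pi> lam] Ieq .
  then show "integral\<^sup>L logs ?h = - lam * risk K \<nu> p \<pi>"
    using integral_nonneg_AE[OF h0] pos by (simp only: ennreal_inj)
qed

text \<open>Integrability follows from y / (1 + y) \<le> y. The integrand of \<open>S_lin\<close>
  times \<open>lam\<close> squared is the weight times y - y / (1 + y), so the value follows by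
  subtraction from \<open>integral_weight_ratio_eq\<close>.\<close>

lemma
  assumes \<pi>: "is_policy X K \<pi>" and lam: "0 < lam"
    and cov: "AE x in \<nu>. \<forall>a\<in>{1..K}. \<pi> x a > 0 \<longrightarrow> \<pi>0 x a > 0"
  shows integrable_weight_shrunk_ratio:
      "integrable logs (\<lambda>z. weight \<pi> z * (ratio lam z / (1 + ratio lam z)))"
    and integral_weight_shrunk_ratio:
      "(\<integral> z. weight \<pi> z * (ratio lam z / (1 + ratio lam z)) \<partial>logs)
        = - lam * risk K \<nu> p \<pi> - lam\<^sup>2 * S_lin X K \<nu> \<pi>0 p lam \<pi>"
proof -
  let ?y = "ratio lam"
  let ?s = "\<lambda>(x, a, c). \<pi> x a * c\<^sup>2 / ((\<pi>0 x a)\<^sup>2 - lam * \<pi>0 x a * c)"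
  note int = integrable_weight_ratio[OF \<pi> less_imp_le[OF lam]]
  have y0: "0 \<le> ?y z" if "z \<in> space logs" for z
    using ratio_nonneg[OF less_imp_le[OF lam] that] .
  show int': "integrable logs (\<lambda>z. weight \<pi> z * (?y z / (1 + ?y z)))"
  proof (rule Bochner_Integration.integrable_bound[OF int _ AE_I2])
    show "(\<lambda>z. weight \<pi> z * (?y z / (1 + ?y z))) \<in> borel_measurable logs"
      unfolding measurable_cong_sets[OF sets_logs refl]
      by (intro borel_measurable_times borel_measurable_divide borel_measurable_add
          borel_measurable_const weight_measurable ratio_measurable \<pi>)
    fix z assume z: "z \<in> space logs"
    have "?y z / (1 + ?y z) \<le> ?y z"
      using y0[OF z] by (simp add: divide_simps algebra_simps)
    then show "norm (weight \<pi> z * (?y z / (1 + ?y z))) \<le> norm (weight \<pi> z * ?y z)"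
      unfolding norm_mult using y0[OF z] by (intro mult_left_mono) simp_all
  qed
  \<comment> \<open>For nonzero \<open>\<pi>0 x a\<close> this is field algebra with 1 + y = (\<pi>0
    - lam c) / \<pi>0. If \<open>\<pi>0 x a\<close> is 0, all quotients are 0 by convention and both
    sides vanish.\<close>
  have s: "lam\<^sup>2 * ?s z = weight \<pi> z * ?y z - weight \<pi> z * (?y z / (1 + ?y z))"
    if z: "z \<in> space logs" for z
  proof -
    obtain x a c where zz: "z = (x, a, c)" by (cases z)
    show ?thesis
    proof (cases "\<pi>0 x a = 0")
      case False
      have "1 + ?y z \<noteq> 0" using y0[OF z] by linarith
      then have ne: "\<pi>0 x a - lam * c \<noteq> 0"
        using False by (auto simp: ratio_def zz field_simps)
      have "1 + ?y z = (\<pi>0 x a - lam * c) / \<pi>0 x a"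
        using False by (simp add: ratio_def zz field_simps)
      moreover have "(\<pi>0 x a)\<^sup>2 - lam * \<pi>0 x a * c = \<pi>0 x a * (\<pi>0 x a - lam * c)"
        by (simp add: power2_eq_square algebra_simps)
      ultimately show ?thesis
        using False ne by (simp add: ratio_def zz power2_eq_square divide_simps) (simp add: algebra_simps)
    qed (simp add: zz ratio_def)
  qed
  have "lam\<^sup>2 * S_lin X K \<nu> \<pi>0 p lam \<pi> = (\<integral> z. lam\<^sup>2 * ?s z \<partial>logs)"
    unfolding S_lin_def by (rule integral_mult_right_zero[symmetric])
  also have "\<dots> = (\<integral> z. weight \<pi> z * ?y z - weight \<pi> z * (?y z / (1 + ?y z)) \<partial>logs)"
    by (rule Bochner_Integration.integral_cong[OF refl s])
  also have "\<dots> = - lam * risk K \<nu> p \<pi> - (\<integral> z. weight \<pi> z * (?y z / (1 + ?y z)) \<partial>logs)"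
    unfolding Bochner_Integration.integral_diff[OF int int']
      integral_weight_ratio_eq[OF \<pi> less_imp_le[OF lam] cov] ..
  finally show "(\<integral> z. weight \<pi> z * (?y z / (1 + ?y z)) \<partial>logs)
        = - lam * risk K \<nu> p \<pi> - lam\<^sup>2 * S_lin X K \<nu> \<pi>0 p lam \<pi>" by simp
qed

section \<open>The sample and the exponential moments of the estimator\<close>

abbreviation data :: "nat \<Rightarrow> (nat \<Rightarrow> (real ^ 'd) \<times> nat \<times> real) measure" where
  "data n \<equiv> data_dist X K \<nu> \<pi>0 p n"

lemma prob_space_data: "prob_space (data n)"
  unfolding data_dist_def by (intro prob_space_PiM prob_space_logs)

lemma space_data_component: "D \<in> space (data n) \<Longrightarrow> i \<in> {1..n} \<Longrightarrow> D i \<in> space logs"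
  unfolding data_dist_def space_PiM by (rule PiE_mem)

lemma data_component_measurable: "i \<in> {1..n} \<Longrightarrow> (\<lambda>D. D i) \<in> data n \<rightarrow>\<^sub>M log_space X K"
  unfolding data_dist_def measurable_cong_sets[OF refl sets_logs[symmetric]]
  by (rule measurable_component_singleton)

lemma lin_risk_estimate_eq:
  "lin_risk_estimate lam \<pi>0 n D \<pi>
    = - (1 / (lam * real n)) * (\<Sum>i\<in>{1..n}. weight \<pi> (D i) * ln (1 + ratio lam (D i)))"
  unfolding lin_risk_estimate_def ratio_def
  by (simp add: sum_distrib_left case_prod_beta' mult.commute mult.left_commute)

lemma lin_risk_estimate_measurable:
  assumes \<pi>: "is_policy X K \<pi>"
  shows "(\<lambda>D. lin_risk_estimate lam \<pi>0 n D \<pi>) \<in> borel_measurable (data n)"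
  unfolding lin_risk_estimate_eq
  by (intro borel_measurable_times borel_measurable_const borel_measurable_sum
      measurable_compose[OF data_component_measurable] borel_measurable_ln borel_measurable_add
      ratio_measurable weight_measurable \<pi>)

text \<open>One tuple contributes \<phi> = \<pi> ln (1 + y) with \<psi> = \<pi> y and b = - lam R.
  Since E[\<psi>] \<le> b holds for every policy, the bound can be applied to each single
  predictor.\<close>

lemma exp_moment_risk_minus_estimate:
  assumes \<pi>: "is_policy X K \<pi>" and lam: "0 < lam" and n: "1 \<le> n"
  shows "(\<integral>\<^sup>+ D. ennreal (exp (lam * real n * (risk K \<nu> p \<pi> - lin_risk_estimate lam \<pi>0 n D \<pi>))) \<partial>data n) \<le> 1"
proof -
  let ?\<phi> = "\<lambda>z. weight \<pi> z * ln (1 + ratio lam z)"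
  let ?b = "- lam * risk K \<nu> p \<pi>"
  have "(\<integral>\<^sup>+ D. ennreal (exp ((\<Sum>i\<in>{1..n}. ?\<phi> (D i)) - real (card {1..n}) * ?b)) \<partial>data n) \<le> 1"
    unfolding data_dist_def
  proof (rule nn_integral_exp_sum_PiM_le_1[OF prob_space_logs _ _ integrable_weight_ratio[OF \<pi>]])
    show "?\<phi> \<in> borel_measurable logs"
      unfolding measurable_cong_sets[OF sets_logs refl]
      by (intro borel_measurable_times borel_measurable_ln borel_measurable_add
          borel_measurable_const weight_measurable ratio_measurable \<pi>)
    fix z assume z: "z \<in> space logs"
    show "exp (?\<phi> z) \<le> 1 + weight \<pi> z * ratio lam z"
      using exp_mult_le_affine[OF weight_bounds[OF \<pi> z], of "ln (1 + ratio lam z)"]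
        ratio_nonneg[OF less_imp_le[OF lam] z] by simp
  qed (use lam integral_weight_ratio_le[OF \<pi>] in auto)
  moreover have "(\<Sum>i\<in>{1..n}. ?\<phi> (D i)) - real (card {1..n}) * ?b
      = lam * real n * (risk K \<nu> p \<pi> - lin_risk_estimate lam \<pi>0 n D \<pi>)" for D
    unfolding lin_risk_estimate_eq using lam n by (simp add: field_simps)
  ultimately show ?thesis by simp
qed

text \<open>The opposite tail, with the sign of \<phi> reversed: \<psi> = - \<pi> y / (1 + y), whose
  mean is exactly b = lam R + lam^2 S under coverage. The difference between y and y / (1 + y) is
  the source of the bias term \<open>S_lin\<close>.\<close>

lemma exp_moment_estimate_minus_risk:
  assumes \<pi>: "is_policy X K \<pi>" and lam: "0 < lam" and n: "1 \<le> n"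
    and cov: "AE x in \<nu>. \<forall>a\<in>{1..K}. \<pi> x a > 0 \<longrightarrow> \<pi>0 x a > 0"
  shows "(\<integral>\<^sup>+ D. ennreal (exp (lam * real n *
      (lin_risk_estimate lam \<pi>0 n D \<pi> - risk K \<nu> p \<pi> - lam * S_lin X K \<nu> \<pi>0 p lam \<pi>))) \<partial>data n) \<le> 1"
proof -
  let ?\<phi> = "\<lambda>z. weight \<pi> z * - ln (1 + ratio lam z)"
  let ?\<psi> = "\<lambda>z. - (weight \<pi> z * (ratio lam z / (1 + ratio lam z)))"
  let ?b = "lam * risk K \<nu> p \<pi> + lam\<^sup>2 * S_lin X K \<nu> \<pi>0 p lam \<pi>"
  note int = integrable_weight_shrunk_ratio[OF \<pi> lam cov]
  have "(\<integral>\<^sup>+ D. ennreal (exp ((\<Sum>i\<in>{1..n}. ?\<phi> (D i)) - real (card {1..n}) * ?b)) \<partial>data n) \<le> 1"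
    unfolding data_dist_def
  proof (rule nn_integral_exp_sum_PiM_le_1[OF prob_space_logs])
    show "?\<phi> \<in> borel_measurable logs"
      unfolding measurable_cong_sets[OF sets_logs refl]
      by (intro borel_measurable_times borel_measurable_uminus borel_measurable_ln borel_measurable_add
          borel_measurable_const weight_measurable ratio_measurable \<pi>)
    show "integrable logs ?\<psi>"
      by (rule Bochner_Integration.integrable_minus[OF int])
    show "integral\<^sup>L logs ?\<psi> \<le> ?b"
      using integral_weight_shrunk_ratio[OF \<pi> lam cov] by simp
    fix z assume z: "z \<in> space logs"
    have y: "0 \<le> ratio lam z" by (rule ratio_nonneg[OF less_imp_le[OF lam] z])
    have "exp (- ln (1 + ratio lam z)) - 1 = - (ratio lam z / (1 + ratio lam z))"
      using y by (simp add: exp_minus field_simps)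
    then show "exp (?\<phi> z) \<le> 1 + ?\<psi> z"
      using exp_mult_le_affine[OF weight_bounds[OF \<pi> z], of "- ln (1 + ratio lam z)"]
      by simp
  qed simp
  moreover have "(\<Sum>i\<in>{1..n}. ?\<phi> (D i)) - real (card {1..n}) * ?b
      = lam * real n * (lin_risk_estimate lam \<pi>0 n D \<pi> - risk K \<nu> p \<pi> - lam * S_lin X K \<nu> \<pi>0 p lam \<pi>)" for D
    unfolding lin_risk_estimate_eq using lam n
    by (simp add: field_simps power2_eq_square sum_negf)
  ultimately show ?thesis by simp
qed

end

section \<open>Predictors and their mixtures\<close>

locale pac_bandit = logged_bandit X K \<nu> \<pi>0 p
  for X :: "(real ^ 'd) set" and K \<nu> \<pi>0 p +
  fixes \<Theta> :: "'t measure" and f :: "'t \<Rightarrow> real ^ 'd \<Rightarrow> nat"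
  assumes predictor_measurable: "(\<lambda>(\<theta>, x). f \<theta> x) \<in> \<Theta> \<Otimes>\<^sub>M context_space X \<rightarrow>\<^sub>M action_space K"
begin

text \<open>Each predictor is viewed as a deterministic policy, so that the exponential moments
  apply to it; \<open>pac_policy f Q\<close> is the mixture of these policies under
  \<open>Q\<close>.\<close>

definition predictor_policy :: "'t \<Rightarrow> 'd policy" where
  "predictor_policy \<theta> x a = of_bool (f \<theta> x = a)"

lemma pac_policy_eq: "pac_policy f Q x a = (\<integral> \<theta>. predictor_policy \<theta> x a \<partial>Q)"
  by (simp add: pac_policy_def predictor_policy_def)

lemma predictor_in_actions: "\<theta> \<in> space \<Theta> \<Longrightarrow> x \<in> X \<Longrightarrow> f \<theta> x \<in> {1..K}"
  using measurable_space[OF predictor_measurable, of "(\<theta>, x)"]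
  by (simp add: space_pair_measure space_context space_action)

lemma predictor_policy_measurable:
  "(\<lambda>(\<theta>, x). predictor_policy \<theta> x a) \<in> borel_measurable (\<Theta> \<Otimes>\<^sub>M context_space X)"
proof -
  have "(\<lambda>b. of_bool (b = a) :: real) \<in> borel_measurable (action_space K)"
    by (simp add: action_space_def)
  from measurable_compose[OF predictor_measurable this] show ?thesis
    by (simp add: predictor_policy_def case_prod_beta')
qed

lemma predictor_policy_measurable_compose:
  assumes t: "t \<in> M \<rightarrow>\<^sub>M \<Theta>" and u: "u \<in> M \<rightarrow>\<^sub>M context_space X"
  shows "(\<lambda>z. predictor_policy (t z) (u z) a) \<in> borel_measurable M"
  using measurable_compose[OF measurable_Pair[OF t u] predictor_policy_measurable] by simp

lemma is_policy_predictor: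
  assumes \<theta>: "\<theta> \<in> space \<Theta>"
  shows "is_policy X K (predictor_policy \<theta>)"
  unfolding is_policy_def
proof (intro conjI ballI)
  fix x assume x: "x \<in> X"
  show "(\<Sum>a\<in>{1..K}. predictor_policy \<theta> x a) = 1"
    using predictor_in_actions[OF \<theta> x] by (simp add: predictor_policy_def of_bool_def)
  show "0 \<le> predictor_policy \<theta> x a" for a
    by (simp add: predictor_policy_def)
next
  show "(\<lambda>x. predictor_policy \<theta> x a) \<in> borel_measurable (context_space X)" for a
    by (rule predictor_policy_measurable_compose[OF measurable_const[OF \<theta>] measurable_ident_sets[OF refl]])
qed

context
  fixes Q :: "'t measure"
  assumes Q: "Q \<in> space (prob_algebra \<Theta>)"
begin

lemma prob_space_Q: "prob_space Q" and sets_Q: "sets Q = sets \<Theta>" and space_Q: "space Q = space \<Theta>"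
  using Q sets_eq_imp_space_eq[of Q \<Theta>] by (simp_all add: space_prob_algebra)

lemma integrable_predictor_policy:
  assumes x: "x \<in> X"
  shows "integrable Q (\<lambda>\<theta>. predictor_policy \<theta> x a)"
proof -
  interpret prob_space Q by (rule prob_space_Q)
  have "(\<lambda>\<theta>. predictor_policy \<theta> x a) \<in> borel_measurable Q"
    unfolding measurable_cong_sets[OF sets_Q refl]
    by (rule predictor_policy_measurable_compose[OF measurable_ident_sets[OF refl] measurable_const])
       (simp add: x space_context)
  then show ?thesis
    by (intro integrable_const_bound[where B=1] AE_I2) (simp_all add: predictor_policy_def)
qed

lemma is_policy_pac: "is_policy X K (pac_policy f Q)"
  unfolding is_policy_def
proof (intro conjI ballI)
  interpret prob_space Q by (rule prob_space_Q)
  fix x assume x: "x \<in> X"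
  have "(\<Sum>a\<in>{1..K}. pac_policy f Q x a) = (\<integral> \<theta>. (\<Sum>a\<in>{1..K}. predictor_policy \<theta> x a) \<partial>Q)"
    unfolding pac_policy_eq
    by (rule Bochner_Integration.integral_sum[symmetric]) (rule integrable_predictor_policy[OF x])
  also have "\<dots> = (\<integral> \<theta>. 1 \<partial>Q)"
    using is_policy_predictor x
    by (intro Bochner_Integration.integral_cong refl) (simp add: is_policy_def space_Q)
  also have "\<dots> = 1" by (simp add: prob_space)
  finally show "(\<Sum>a\<in>{1..K}. pac_policy f Q x a) = 1" .
  show "0 \<le> pac_policy f Q x a" for a
    by (simp add: pac_policy_def)
next
  interpret prob_space Q by (rule prob_space_Q)
  fix a
  have "(\<lambda>(x, \<theta>). predictor_policy \<theta> x a) \<in> borel_measurable (context_space X \<Otimes>\<^sub>M Q)"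
    unfolding case_prod_beta' measurable_cong_sets[OF sets_pair_measure_cong[OF refl sets_Q] refl]
    by (rule predictor_policy_measurable_compose) measurable
  then show "(\<lambda>x. pac_policy f Q x a) \<in> borel_measurable (context_space X)"
    unfolding pac_policy_eq by (rule borel_measurable_lebesgue_integral)
qed

text \<open>The risk is linear in the policy, so mixing policies averages risks. Fubini applies
  because the integrand lies in [-1, 0].\<close>

lemma
  shows integrable_predictor_risk: "integrable Q (\<lambda>\<theta>. risk K \<nu> p (predictor_policy \<theta>))"
    and risk_pac_policy: "risk K \<nu> p (pac_policy f Q) = (\<integral> \<theta>. risk K \<nu> p (predictor_policy \<theta>) \<partial>Q)"
proof -
  interpret Q: prob_space Q by (rule prob_space_Q)
  interpret N: prob_space \<nu> by (rule prob_space_\<nu>)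
  interpret QN: pair_prob_space Q \<nu> ..
  let ?g = "\<lambda>\<theta> x. \<Sum>a\<in>{1..K}. predictor_policy \<theta> x a * mean_cost p x a"
  have "(\<lambda>(\<theta>, x). ?g \<theta> x) \<in> borel_measurable (Q \<Otimes>\<^sub>M \<nu>)"
    unfolding case_prod_beta' measurable_cong_sets[OF sets_pair_measure_cong[OF sets_Q sets_\<nu>] refl]
    by (intro borel_measurable_sum borel_measurable_times predictor_policy_measurable_compose
        measurable_compose[OF measurable_snd mean_cost_measurable]) simp_all
  moreover have "norm (case z of (\<theta>, x) \<Rightarrow> ?g \<theta> x) \<le> 1" if "z \<in> space (Q \<Otimes>\<^sub>M \<nu>)" for z
    using that policy_mean_cost_bounds[OF is_policy_predictor, of "fst z" "snd z"]
    by (cases z) (simp add: space_pair_measure space_Q space_\<nu> abs_le_iff)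
  ultimately have int: "integrable (Q \<Otimes>\<^sub>M \<nu>) (\<lambda>(\<theta>, x). ?g \<theta> x)"
    by (intro QN.P.integrable_const_bound[where B=1] AE_I2)
  have risk_pred: "risk K \<nu> p (predictor_policy \<theta>) = (\<integral> x. ?g \<theta> x \<partial>\<nu>)" for \<theta>
    by (rule risk_eq) (simp add: predictor_policy_def)
  show "integrable Q (\<lambda>\<theta>. risk K \<nu> p (predictor_policy \<theta>))"
    unfolding risk_pred using QN.integrable_fst'[OF int] by simp
  have "risk K \<nu> p (pac_policy f Q) = (\<integral> x. (\<Sum>a\<in>{1..K}. pac_policy f Q x a * mean_cost p x a) \<partial>\<nu>)"
    by (rule risk_policy_eq[OF is_policy_pac])
  also have "\<dots> = (\<integral> x. (\<integral> \<theta>. ?g \<theta> x \<partial>Q) \<partial>\<nu>)"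
  proof (rule Bochner_Integration.integral_cong[OF refl])
    fix x assume "x \<in> space \<nu>"
    then have x: "x \<in> X" by (simp add: space_\<nu>)
    show "(\<Sum>a\<in>{1..K}. pac_policy f Q x a * mean_cost p x a) = (\<integral> \<theta>. ?g \<theta> x \<partial>Q)"
      unfolding pac_policy_eq
      by (subst Bochner_Integration.integral_sum)
         (simp_all add: integrable_predictor_policy[OF x])
  qed
  also have "\<dots> = (\<integral> \<theta>. (\<integral> x. ?g \<theta> x \<partial>\<nu>) \<partial>Q)"
    by (rule QN.Fubini_integral[OF int])
  finally show "risk K \<nu> p (pac_policy f Q) = (\<integral> \<theta>. risk K \<nu> p (predictor_policy \<theta>) \<partial>Q)"
    unfolding risk_pred .
qed

text \<open>For fixed data the logarithms do not involve the policy, whose weights enter linearly.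
  This linearity of the estimator makes the estimate of a mixture a \<open>Q\<close>-integral, the
  form required by Donsker--Varadhan.\<close>

lemma
  assumes D: "D \<in> space (data n)"
  shows integrable_predictor_estimate:
      "integrable Q (\<lambda>\<theta>. lin_risk_estimate lam \<pi>0 n D (predictor_policy \<theta>))"
    and lin_risk_estimate_pac_policy:
      "lin_risk_estimate lam \<pi>0 n D (pac_policy f Q)
        = (\<integral> \<theta>. lin_risk_estimate lam \<pi>0 n D (predictor_policy \<theta>) \<partial>Q)"
proof -
  let ?h = "\<lambda>\<theta> i. weight (predictor_policy \<theta>) (D i) * ln (1 + ratio lam (D i))"
  have int: "integrable Q (\<lambda>\<theta>. ?h \<theta> i)" if "i \<in> {1..n}" for i
    using space_data_component[OF D that]
    by (intro integrable_mult_left integrable_predictor_policy) (auto simp: space_logs)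
  show "integrable Q (\<lambda>\<theta>. lin_risk_estimate lam \<pi>0 n D (predictor_policy \<theta>))"
    unfolding lin_risk_estimate_eq
    by (intro integrable_mult_right Bochner_Integration.integrable_sum int)
  have "(\<Sum>i\<in>{1..n}. weight (pac_policy f Q) (D i) * ln (1 + ratio lam (D i)))
      = (\<Sum>i\<in>{1..n}. \<integral> \<theta>. ?h \<theta> i \<partial>Q)"
    by (simp add: pac_policy_eq)
  also have "\<dots> = (\<integral> \<theta>. (\<Sum>i\<in>{1..n}. ?h \<theta> i) \<partial>Q)"
    by (rule Bochner_Integration.integral_sum[symmetric, OF int])
  finally show "lin_risk_estimate lam \<pi>0 n D (pac_policy f Q)
        = (\<integral> \<theta>. lin_risk_estimate lam \<pi>0 n D (predictor_policy \<theta>) \<partial>Q)"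
    unfolding lin_risk_estimate_eq by simp
qed

end

section \<open>Bounds with high probability\<close>

lemma predictor_estimate_measurable:
  "(\<lambda>(\<theta>, D). lin_risk_estimate lam \<pi>0 n D (predictor_policy \<theta>)) \<in> borel_measurable (\<Theta> \<Otimes>\<^sub>M data n)"
  unfolding lin_risk_estimate_eq case_prod_beta'
proof (intro borel_measurable_times borel_measurable_const borel_measurable_sum)
  fix i assume i: "i \<in> {1..n}"
  have Di: "(\<lambda>w. snd w i) \<in> \<Theta> \<Otimes>\<^sub>M data n \<rightarrow>\<^sub>M log_space X K"
    by (rule measurable_compose[OF measurable_snd data_component_measurable[OF i]])
  show "(\<lambda>w. weight (predictor_policy (fst w)) (snd w i)) \<in> borel_measurable (\<Theta> \<Otimes>\<^sub>M data n)"
    by (rule measurable_action_apply[OF predictor_policy_measurable_compose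
          measurable_compose[OF Di action_proj_measurable]])
       (rule measurable_fst measurable_compose[OF Di context_proj_measurable])+
  show "(\<lambda>w. ln (1 + ratio lam (snd w i))) \<in> borel_measurable (\<Theta> \<Otimes>\<^sub>M data n)"
    by (intro borel_measurable_ln borel_measurable_add borel_measurable_const
        measurable_compose[OF Di ratio_measurable])
qed

text \<open>
  The prior \<open>P\<close> does not depend on the data, so Tonelli turns the exponential moment of each single
  predictor into one for the \<open>P\<close>-average; Donsker--Varadhan then makes the bound uniform in \<open>Q\<close>.
\<close>

lemma pac_bayes_risk_bound:
  assumes P: "P \<in> space (prob_algebra \<Theta>)" and lam: "0 < lam" and n: "1 \<le> n" and \<epsilon>: "0 < \<epsilon>"
  shows "\<exists>E \<in> sets (data n). measure (data n) E \<ge> 1 - \<epsilon> \<and>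
    (\<forall>D\<in>E. \<forall>Q \<in> space (prob_algebra \<Theta>).
       ereal (lam * real n * (risk K \<nu> p (pac_policy f Q) - lin_risk_estimate lam \<pi>0 n D (pac_policy f Q)))
         \<le> KL Q P + ereal (ln (1 / \<epsilon>)))"
proof -
  interpret DD: prob_space "data n" by (rule prob_space_data)
  interpret P: prob_space P by (rule prob_space_Q[OF P])
  interpret PD: pair_prob_space P "data n" ..
  let ?h = "\<lambda>D \<theta>. lam * real n * (risk K \<nu> p (predictor_policy \<theta>) - lin_risk_estimate lam \<pi>0 n D (predictor_policy \<theta>))"
  let ?u = "\<lambda>D. \<integral>\<^sup>+ \<theta>. ennreal (exp (?h D \<theta>)) \<partial>P"
  have rm: "(\<lambda>\<theta>. risk K \<nu> p (predictor_policy \<theta>)) \<in> borel_measurable P"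
    by (rule borel_measurable_integrable[OF integrable_predictor_risk[OF P]])
  \<comment> \<open>Measurability jointly in parameter and data is the condition for exchanging the
    integrals over the prior and the sample.\<close>
  have em: "(\<lambda>w. lin_risk_estimate lam \<pi>0 n (snd w) (predictor_policy (fst w))) \<in> borel_measurable (P \<Otimes>\<^sub>M data n)"
    using predictor_estimate_measurable[of lam n]
    unfolding case_prod_beta' measurable_cong_sets[OF sets_pair_measure_cong[OF sets_Q[OF P] refl] refl] .
  have "(\<lambda>w. ?h (snd w) (fst w)) \<in> borel_measurable (P \<Otimes>\<^sub>M data n)"
    by (intro borel_measurable_times borel_measurable_diff borel_measurable_const em
        measurable_compose[OF measurable_fst rm])
  then have hm: "(\<lambda>w. ennreal (exp (?h (snd w) (fst w)))) \<in> borel_measurable (P \<Otimes>\<^sub>M data n)"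
    by (intro measurable_compose[OF _ measurable_ennreal] measurable_compose[OF _ borel_measurable_exp])
  have um: "?u \<in> borel_measurable (data n)"
    using P.borel_measurable_nn_integral_fst[OF measurable_compose[OF measurable_pair_swap' hm]]
    by simp
  have "(\<integral>\<^sup>+ D. ?u D \<partial>data n) = (\<integral>\<^sup>+ \<theta>. (\<integral>\<^sup>+ D. ennreal (exp (?h D \<theta>)) \<partial>data n) \<partial>P)"
    using PD.Fubini[OF hm] by simp
  also have "\<dots> \<le> (\<integral>\<^sup>+ \<theta>. 1 \<partial>P)"
    by (intro nn_integral_mono exp_moment_risk_minus_estimate is_policy_predictor lam n)
       (simp add: space_Q[OF P])
  also have "\<dots> = 1" by (simp add: P.emeasure_space_1)
  finally have u1: "(\<integral>\<^sup>+ D. ?u D \<partial>data n) \<le> 1" .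
  \<comment> \<open>The event is defined through the prior average alone and does not mention
    \<open>Q\<close>, so a single event serves all \<open>Q\<close> at once.\<close>
  let ?E = "{D \<in> space (data n). ?u D \<le> ennreal (1 / \<epsilon>)}"
  show ?thesis
  proof (intro bexI[of _ ?E] conjI ballI)
    show "?E \<in> sets (data n)"
      by (rule borel_measurable_le[OF um borel_measurable_const, unfolded pred_def])
    show "measure (data n) ?E \<ge> 1 - \<epsilon>"
      by (rule DD.prob_le_inverse_ge[OF um u1 \<epsilon>])
    fix D Q assume "D \<in> ?E" and Q: "Q \<in> space (prob_algebra \<Theta>)"
    then have D: "D \<in> space (data n)" and u: "?u D \<le> ennreal (1 / \<epsilon>)" by auto
    have int: "integrable Q (?h D)"
      by (intro integrable_mult_right Bochner_Integration.integrable_diff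
          integrable_predictor_risk integrable_predictor_estimate Q D)
    have eq: "lam * real n * (risk K \<nu> p (pac_policy f Q) - lin_risk_estimate lam \<pi>0 n D (pac_policy f Q))
        = integral\<^sup>L Q (?h D)"
      using integrable_predictor_risk[OF Q] integrable_predictor_estimate[OF Q D]
      by (simp add: risk_pac_policy[OF Q] lin_risk_estimate_pac_policy[OF Q D])
    show "ereal (lam * real n * (risk K \<nu> p (pac_policy f Q) - lin_risk_estimate lam \<pi>0 n D (pac_policy f Q)))
         \<le> KL Q P + ereal (ln (1 / \<epsilon>))"
    \<comment> \<open>Either \<open>KL Q P\<close> is the real divergence and Donsker--Varadhan
      applies with C = 1 / \<epsilon>, or it is infinite and the bound is trivial.\<close>
    proof (cases "absolutely_continuous P Q \<and> integrable Q (entropy_density (exp 1) P Q)")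
      case True
      then have "integral\<^sup>L Q (?h D) \<le> KL_divergence (exp 1) P Q + ln (1 / \<epsilon>)"
        using sets_Q[OF Q] sets_Q[OF P] \<epsilon>
        by (intro donsker_varadhan P.prob_space_axioms prob_space_Q Q int u) simp_all
      with True show ?thesis by (simp add: KL_def eq)
    qed (auto simp: KL_def)
  qed
qed

text \<open>Markov's inequality for one fixed policy. It serves the policy of \<open>Qs\<close>,
  which is chosen independently of the data and therefore costs no divergence term here.\<close>

lemma estimate_upper_bound:
  assumes \<pi>: "is_policy X K \<pi>" and lam: "0 < lam" and n: "1 \<le> n" and \<epsilon>: "0 < \<epsilon>"
    and cov: "AE x in \<nu>. \<forall>a\<in>{1..K}. \<pi> x a > 0 \<longrightarrow> \<pi>0 x a > 0"
  shows "\<exists>E \<in> sets (data n). measure (data n) E \<ge> 1 - \<epsilon> \<and>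
    (\<forall>D\<in>E. lam * real n * (lin_risk_estimate lam \<pi>0 n D \<pi> - risk K \<nu> p \<pi> - lam * S_lin X K \<nu> \<pi>0 p lam \<pi>)
         \<le> ln (1 / \<epsilon>))"
proof -
  interpret DD: prob_space "data n" by (rule prob_space_data)
  let ?h = "\<lambda>D. lam * real n * (lin_risk_estimate lam \<pi>0 n D \<pi> - risk K \<nu> p \<pi> - lam * S_lin X K \<nu> \<pi>0 p lam \<pi>)"
  have "?h \<in> borel_measurable (data n)"
    by (intro borel_measurable_times borel_measurable_diff borel_measurable_const
        lin_risk_estimate_measurable \<pi>)
  then have um: "(\<lambda>D. ennreal (exp (?h D))) \<in> borel_measurable (data n)"
    by (intro measurable_compose[OF _ measurable_ennreal] measurable_compose[OF _ borel_measurable_exp])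
  let ?E = "{D \<in> space (data n). ennreal (exp (?h D)) \<le> ennreal (1 / \<epsilon>)}"
  show ?thesis
  proof (intro bexI[of _ ?E] conjI ballI)
    show "?E \<in> sets (data n)"
      by (rule borel_measurable_le[OF um borel_measurable_const, unfolded pred_def])
    show "measure (data n) ?E \<ge> 1 - \<epsilon>"
      by (rule DD.prob_le_inverse_ge[OF um exp_moment_estimate_minus_risk[OF \<pi> lam n cov] \<epsilon>])
    fix D assume "D \<in> ?E"
    then have "exp (?h D) \<le> 1 / \<epsilon>" using \<epsilon> by simp
    then show "?h D \<le> ln (1 / \<epsilon>)" using \<epsilon> by (simp add: ln_ge_iff)
  qed
qed

end

section \<open>Combination into the bound on the excess risk\<close>

lemma KL_nonneg:
  assumes "prob_space P" "prob_space Q" "sets Q = sets P"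
  shows "0 \<le> KL Q P"
proof (cases "absolutely_continuous P Q \<and> integrable Q (entropy_density (exp 1) P Q)")
  case True
  \<comment> \<open>For the zero function the exponential moment under \<open>P\<close> is 1, so
    Donsker--Varadhan with C = 1 reads 0 \<le> KL.\<close>
  then show ?thesis
    using donsker_varadhan[of P Q "\<lambda>_. 0" 1] assms prob_space.emeasure_space_1[OF assms(1)]
    by (simp add: KL_def)
qed (auto simp: KL_def)

text \<open>A union bound in the form of inclusion-exclusion. The null set will contain the samples
  for which \<open>Qn\<close> fails to be a minimiser.\<close>

lemma (in prob_space) prob_Int_Int_almost_sure:
  assumes "A \<in> events" "B \<in> events" "N \<in> null_sets M"
    and "1 - \<epsilon> / 2 \<le> prob A" "1 - \<epsilon> / 2 \<le> prob B"
  shows "1 - \<epsilon> \<le> prob (A \<inter> B - N)"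
proof -
  have "prob A + prob B = prob (A \<union> B) + prob (A \<inter> B)"
    using finite_measure_Union'[OF assms(1,2)] finite_measure_Diff'[OF assms(2,1)]
    by (simp add: Int_commute)
  moreover have "prob (A \<inter> B - N) = prob (A \<inter> B)"
    using assms(1-3) by (intro measure_Diff_null_set) auto
  ultimately show ?thesis
    using prob_le_1[of "A \<union> B"] assms(4,5) by linarith
qed

theorem proposition11:
  fixes X :: "(real ^ 'd) set" and K n :: nat
    and \<nu> :: "(real ^ 'd) measure"
    and \<pi>0 :: "'d policy"
    and p :: "real ^ 'd \<Rightarrow> nat \<Rightarrow> real measure"
    and \<Theta> :: "'t measure"
    and f :: "'t \<Rightarrow> real ^ 'd \<Rightarrow> nat"
    and L :: "'t measure set"
    and P Qs :: "'t measure"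
    and Qn :: "(nat \<Rightarrow> (real ^ 'd) \<times> nat \<times> real) \<Rightarrow> 't measure"
    and lam \<delta> :: real
  assumes "compact X"
    and "\<nu> \<in> space (prob_algebra (context_space X))"
    and "is_policy X K \<pi>0"
    and "(\<lambda>(x, a). p x a) \<in> context_space X \<Otimes>\<^sub>M action_space K \<rightarrow>\<^sub>M prob_algebra cost_space"
    and "(\<lambda>(\<theta>, x). f \<theta> x) \<in> \<Theta> \<Otimes>\<^sub>M context_space X \<rightarrow>\<^sub>M action_space K"
    and "n \<ge> 1" and "lam > 0" and "0 < \<delta>" and "\<delta> \<le> 1"
    and "L \<subseteq> space (prob_algebra \<Theta>)" and "P \<in> L"
    and "AE D in data_dist X K \<nu> \<pi>0 p n.
           is_arg_min (\<lambda>Q. ereal (lin_risk_estimate lam \<pi>0 n D (pac_policy f Q))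
                            + KL Q P / ereal (lam * real n))
                      (\<lambda>Q. Q \<in> L) (Qn D)"
    and "is_arg_min (\<lambda>Q. risk K \<nu> p (pac_policy f Q)) (\<lambda>Q. Q \<in> L) Qs"
    and "AE x in \<nu>. \<forall>a\<in>{1..K}. pac_policy f Qs x a > 0 \<longrightarrow> \<pi>0 x a > 0"
  shows "\<exists>E\<in>sets (data_dist X K \<nu> \<pi>0 p n).
           measure (data_dist X K \<nu> \<pi>0 p n) E \<ge> 1 - \<delta> \<and>
           (\<forall>D\<in>E.
              0 \<le> risk K \<nu> p (pac_policy f (Qn D)) - risk K \<nu> p (pac_policy f Qs) \<and>
              ereal (risk K \<nu> p (pac_policy f (Qn D)) - risk K \<nu> p (pac_policy f Qs))
                \<le> ereal (lam * S_lin X K \<nu> \<pi>0 p lam (pac_policy f Qs))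
                   + 2 * (KL Qs P + ereal (ln (2 / \<delta>))) / ereal (lam * real n))"
proof -
  interpret pac_bandit X K \<nu> \<pi>0 p \<Theta> f
    by unfold_locales fact+
  interpret DD: prob_space "data n" by (rule prob_space_data)
  let ?obj = "\<lambda>D Q. ereal (lin_risk_estimate lam \<pi>0 n D (pac_policy f Q)) + KL Q P / ereal (lam * real n)"
  let ?R = "\<lambda>Q. risk K \<nu> p (pac_policy f Q)"
  let ?S = "S_lin X K \<nu> \<pi>0 p lam (pac_policy f Qs)"
  have P: "P \<in> space (prob_algebra \<Theta>)" and Qs: "Qs \<in> L" "Qs \<in> space (prob_algebra \<Theta>)"
    using assms(10,11,13) by (auto simp: is_arg_min_def)
  \<comment> \<open>Each of the two events may fail with probability \<delta> / 2, whence the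
    logarithm of 2 / \<delta>.\<close>
  have \<epsilon>: "0 < \<delta> / 2" and m: "0 < lam * real n" using assms(6-8) by auto
  obtain E1 where E1: "E1 \<in> sets (data n)" "measure (data n) E1 \<ge> 1 - \<delta> / 2"
    and upper: "\<And>D Q. D \<in> E1 \<Longrightarrow> Q \<in> space (prob_algebra \<Theta>) \<Longrightarrow>
       ereal (lam * real n * (?R Q - lin_risk_estimate lam \<pi>0 n D (pac_policy f Q)))
         \<le> KL Q P + ereal (ln (2 / \<delta>))"
    using pac_bayes_risk_bound[OF P assms(7,6) \<epsilon>] by auto
  obtain E2 where E2: "E2 \<in> sets (data n)" "measure (data n) E2 \<ge> 1 - \<delta> / 2"
    and lower: "\<And>D. D \<in> E2 \<Longrightarrow>
       lam * real n * (lin_risk_estimate lam \<pi>0 n D (pac_policy f Qs) - ?R Qs - lam * ?S) \<le> ln (2 / \<delta>)"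
    using estimate_upper_bound[OF is_policy_pac[OF Qs(2)] assms(7,6) \<epsilon> assms(14)] by auto
  \<comment> \<open>The final event is built from \<open>E1\<close>, \<open>E2\<close> and
    \<open>N\<close> alone, so its measurability does not rest on how \<open>Qn\<close> depends on
    the data.\<close>
  obtain N where N: "N \<in> null_sets (data n)"
    and argmin: "\<And>D. D \<in> space (data n) - N \<Longrightarrow> is_arg_min (?obj D) (\<lambda>Q. Q \<in> L) (Qn D)"
    using AE_E3[OF assms(12)] by blast
  show ?thesis
  proof (intro bexI[of _ "E1 \<inter> E2 - N"] conjI ballI)
    show "E1 \<inter> E2 - N \<in> sets (data n)"
      using E1 E2 N by auto
    show "1 - \<delta> \<le> measure (data n) (E1 \<inter> E2 - N)"
      using E1 E2 N by (intro DD.prob_Int_Int_almost_sure)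
    fix D assume "D \<in> E1 \<inter> E2 - N"
    then have D: "D \<in> E1" "D \<in> E2" and am: "is_arg_min (?obj D) (\<lambda>Q. Q \<in> L) (Qn D)"
      using argmin sets.sets_into_space[OF E1(1)] by auto
    then have Qn: "Qn D \<in> L" "Qn D \<in> space (prob_algebra \<Theta>)" and opt: "?obj D (Qn D) \<le> ?obj D Qs"
      using assms(10) Qs(1) by (auto simp: is_arg_min_def not_less)
    show "0 \<le> ?R (Qn D) - ?R Qs"
      using assms(13) Qn(1) by (auto simp: is_arg_min_def not_less)
    have KL0: "0 \<le> KL Q P" if "Q \<in> space (prob_algebra \<Theta>)" for Q
      using that P by (intro KL_nonneg) (auto simp: space_prob_algebra)
    show "ereal (?R (Qn D) - ?R Qs)
        \<le> ereal (lam * ?S) + 2 * (KL Qs P + ereal (ln (2 / \<delta>))) / ereal (lam * real n)"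
    proof (cases "KL Qs P")
      case PInf
      then show ?thesis using assms(6,7) by simp
    next
      case MInf
      then show ?thesis using KL0[OF Qs(2)] by simp
    next
      case (real ks)
      \<comment> \<open>The objective is finite at \<open>Qs\<close>, hence at its minimiser;
        together with nonnegativity this makes the divergence of \<open>Qn D\<close> a real
        number.\<close>
      then obtain kn where kn: "KL (Qn D) P = ereal kn"
        using opt assms(6,7) KL0[OF Qn(2)] by (cases "KL (Qn D) P") auto
      let ?r = "\<lambda>Q. lin_risk_estimate lam \<pi>0 n D (pac_policy f Q)"
      have ks: "0 \<le> ks" using KL0[OF Qs(2)] real by simp
      have "?r (Qn D) + kn / (lam * real n) \<le> ?r Qs + ks / (lam * real n)"
        using opt real kn assms(6,7) by simp
      from mult_left_mono[OF this less_imp_le[OF m]]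
      have o: "lam * real n * ?r (Qn D) + kn \<le> lam * real n * ?r Qs + ks"
        using assms(6,7) by (simp add: distrib_left)
      have u: "lam * real n * (?R (Qn D) - ?r (Qn D)) \<le> kn + ln (2 / \<delta>)"
        using upper[OF D(1) Qn(2)] kn by simp
      \<comment> \<open>Adding \<open>u\<close>, \<open>o\<close> and the bound for
        \<open>Qs\<close> cancels \<open>kn\<close> and both estimates and leaves ks + 2 ln (2 /
        \<delta>); as \<open>ks\<close> is nonnegative, it may be doubled.\<close>
      have "lam * real n * (?R (Qn D) - ?R Qs) \<le> lam * real n * (lam * ?S) + 2 * (ks + ln (2 / \<delta>))"
        using o u lower[OF D(2)] ks unfolding right_diff_distrib by argo
      then have "(?R (Qn D) - ?R Qs - lam * ?S) * (lam * real n) \<le> 2 * (ks + ln (2 / \<delta>))"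
        by (simp only: algebra_simps)
      then have "?R (Qn D) - ?R Qs - lam * ?S \<le> 2 * (ks + ln (2 / \<delta>)) / (lam * real n)"
        by (simp only: pos_le_divide_eq[OF m])
      then have "?R (Qn D) - ?R Qs \<le> lam * ?S + 2 * (ks + ln (2 / \<delta>)) / (lam * real n)"
        by linarith
      then show ?thesis using real assms(6,7) by simp
    qed
  qed
qed

end
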